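(* (a) Assume that $X=(X_i)_{i\in\mathbb{N}}$ is equal in distribution to $X^\nu$ (so $X\in\mathcal{R}$), where $$\nu=c\sum_{i\in\mathbb{N}}\delta_{\{i\}}+\int_{(0,1]}\Pi_x\,d\sigma(x)$$ with $c\ge0$ and $\sigma$ a measure on $(0,1]$ satisfying $\int_{(0,1]} x\,d\sigma(x)<\infty$. Let $\mu$ be the probability measure on $[0,1]$ such that $X\sim\int_0^1\Pi_p\,d\mu(p)$. Let $\varphi:[0,1]\to[0,\infty]$, $\varphi(x)=-\log(1-x)$, and let $Z=\varphi(Q)$ where $Q\sim\mu$. Then (i) $Z$ is infinitely divisible, (ii) $\hat\sigma=\sigma\circ\varphi^{-1}$ (the push-forward of $\sigma$ under $\varphi$), and (iii) $\gamma=\nu(\{\{1\}\})$, where $\gamma$ and $\hat\sigma$ are the drift and Lévy measure of $Z$. (b) Let $Z$ be an infinitely divisible random variable on $[0,\infty]$, with drift $\gamma$ and Lévy measure $\hat\sigma$. Let $\phi=\varphi^{-1}:[0,\infty]\to[0,1]$, $\phi(x)=1-e^{-x}$, let $\mu$ be the law of $\phi(Z)$, and let $X\sim\int_0^1\Pi_p\,d\mu(p)$. Then (i) $X\in\mathcal{R}$, and $X$ is equal in distribution to $X^\nu$ for a measure $\nu$ of the form $\nu=c\sum_{i\in\mathbb{N}}\delta_{\{i\}}+\int_{(0,1]}\Pi_x\,d\sigma(x)$ with $c\ge 0$ and $\int_{(0,1]} x\,d\sigma(x)<\infty$, for which (ii) $\sigma=\hat\sigma\circ\phi^{-1}$ (the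 push-forward of $\hat\sigma$ under $\phi$), and (iii) $\nu(\{\{1\}\})=\gamma$.
   Context: Let $S$ be a finite or countably infinite set, and identify the power set $\mathcal{P}(S)$ with $\{0,1\}^S$ (product topology, Borel $\sigma$-algebra). For a $\sigma$-finite measure $\nu$ on $\mathcal{P}(S)\setminus\{\emptyset\}$, let $Y^\nu=\{B_j\}_{j\in I}$ be the Poisson process on $\mathcal{P}(S)\setminus\{\emptyset\}$ with intensity measure $\nu$. Define $X^\nu=(X^\nu_i)_{i\in S}$ by $X^\nu_i=1$ if $i\in\bigcup_{j\in I}B_j$ and $X^\nu_i=0$ otherwise. $\mathcal{R}$ denotes the set of all $\{0,1\}$-valued processes $(X_i)_{i\in S}$ that are equal in distribution to $X^\nu$ for some $\nu$. Here $S=\mathbb{N}$. $\Pi_p$ is the product measure on $\{0,1\}^{\mathbb{N}}$ (equivalently on $\mathcal{P}(\mathbb{N})$) in which each coordinate equals $1$ with probability $p$. By de Finetti's theorem, a $\{0,1\}$-valued process indexed by $\mathbb{N}$ that is invariant under finite permutations has law $\int_0^1\Pi_p\,d\mu(p)$ for a unique probability measure $\mu$ on $[0,1]$. A random variable $Z$ on $[0,\infty)$ is infinitely divisible if and only if $$\mathbb{E}[e^{-tZ}]=e^{-\gamma t}\,e^{\int(e^{-st}-1)\,d\hat\sigma(s)},\qquad t>0,$$ where $\gamma\ge0$ (the drift) and $\hat\sigma$ (the Lévy measure) is a measure on $(0,\infty)$ with $\hat\sigma((\varepsilon,\infty))<\infty$ for all $\varepsilon>0$ and $\int_{(0,1]}s\,d\hat\sigma(s)<\infty$.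 More generally, a random variable $Z$ on $[0,\infty]$ is called infinitely divisible if its law is $p\,\mathcal{L}(Z')+(1-p)\delta_\infty$ with $p\in(0,1]$ and $Z'$ infinitely divisible on $[0,\infty)$; in that case the same formula holds with $\hat\sigma$ a measure on $(0,\infty]$ satisfying $\hat\sigma((\varepsilon,\infty])<\infty$ for all $\varepsilon>0$ and $\int_{(0,1]}s\,d\hat\sigma(s)<\infty$, with the convention $e^{-t\cdot\infty}=0$ for $t>0$ (so $\hat\sigma(\{\infty\})=-\log p$). The pair $(\gamma,\hat\sigma)$ is unique. *)

theory Defs
  imports "HOL-Probability.Probability"
begin

section \<open>Subsets as indicator functions\<close>

text \<open>
  A subset of a countable type \<open>'a\<close> is identified with its indicator function \<open>'a \<Rightarrow> bool\<close>,
  and a \<open>{0,1}\<close>-valued process indexed by \<open>'a\<close> with an \<open>('a \<Rightarrow> bool)\<close>-valued random variable.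
  The measure \<open>borel\<close> on \<open>'a \<Rightarrow> bool\<close> carries the Borel sigma-algebra of the product topology.
\<close>

definition nonempty_subsets :: "('a::countable \<Rightarrow> bool) measure" where
  "nonempty_subsets = restrict_space borel {B. \<exists>i. B i}"

definition singleton_subset :: "'a \<Rightarrow> ('a \<Rightarrow> bool)" where
  "singleton_subset i = (\<lambda>j. j = i)"


section \<open>Poisson processes and the class R\<close>

text \<open>
  A countable family \<open>{B\<^sub>j}\<^bsub>j \<in> I\<^esub>\<close> of points, repetitions allowed, is a
  sequence \<open>y :: nat \<Rightarrow> 'e option\<close>: \<open>y j = Some B\<close> means \<open>j \<in> I\<close> and \<open>B\<^sub>j = B\<close>,
  and \<open>y j = None\<close> means \<open>j \<notin> I\<close>.
\<close>

definition num_points :: "(nat \<Rightarrow> 'e option) \<Rightarrow> 'e set \<Rightarrow> ennreal" where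
  "num_points y A = emeasure (count_space UNIV) {j. \<exists>b\<in>A. y j = Some b}"

text \<open>
  The number of points in \<open>A\<close> is Poisson with mean \<open>\<nu>(A)\<close> (almost surely infinite if
  \<open>\<nu>(A) = \<infinity>\<close>), and the numbers of points in disjoint sets are independent. The Poisson weights
  are written out because \<open>poisson_pmf\<close> excludes the mean \<open>0\<close>.
\<close>

definition poisson_process :: "'w measure \<Rightarrow> ('w \<Rightarrow> nat \<Rightarrow> 'e option) \<Rightarrow> 'e measure \<Rightarrow> bool" where
  "poisson_process P Y \<nu> \<longleftrightarrow>
     prob_space P \<and>
     (\<forall>\<omega>\<in>space P. \<forall>j b. Y \<omega> j = Some b \<longrightarrow> b \<in> space \<nu>) \<and>
     (\<forall>A\<in>sets \<nu>. (\<lambda>\<omega>. num_points (Y \<omega>) A) \<in> borel_measurable P) \<and>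
     (\<forall>A\<in>sets \<nu>. emeasure \<nu> A < \<infinity> \<longrightarrow>
        (\<forall>n::nat. measure P {\<omega>\<in>space P. num_points (Y \<omega>) A = of_nat n} =
           measure \<nu> A ^ n / fact n * exp (- measure \<nu> A))) \<and>
     (\<forall>A\<in>sets \<nu>. emeasure \<nu> A = \<infinity> \<longrightarrow> (AE \<omega> in P. num_points (Y \<omega>) A = \<infinity>)) \<and>
     (\<forall>\<A>. finite \<A> \<and> \<A> \<subseteq> sets \<nu> \<and> disjoint \<A> \<longrightarrow>
        prob_space.indep_vars P (\<lambda>_. borel) (\<lambda>A \<omega>. num_points (Y \<omega>) A) \<A>)"

definition union_process :: "('w \<Rightarrow> nat \<Rightarrow> ('a \<Rightarrow> bool) option) \<Rightarrow> 'w \<Rightarrow> ('a \<Rightarrow> bool)" where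
  "union_process Y \<omega> = (\<lambda>i. \<exists>j B. Y \<omega> j = Some B \<and> B i)"

text \<open>
  \<open>X\<close> (defined on \<open>M\<close>) is equal in distribution to \<open>X\<^sup>\<nu>\<close>. The Poisson process lives on some
  probability space over the type \<open>nat \<Rightarrow> ('a \<Rightarrow> bool) option\<close> of all point families. This is no
  restriction: a Poisson process on any probability space is carried to this type by \<open>Y\<close> itself.
\<close>

definition distributed_as_X ::
    "'w measure \<Rightarrow> ('w \<Rightarrow> ('a::countable \<Rightarrow> bool)) \<Rightarrow> ('a \<Rightarrow> bool) measure \<Rightarrow> bool" where
  "distributed_as_X M X \<nu> \<longleftrightarrow>
     X \<in> measurable M borel \<and>
     sets \<nu> = sets nonempty_subsets \<and> sigma_finite_measure \<nu> \<and>
     (\<exists>(P :: (nat \<Rightarrow> ('a \<Rightarrow> bool) option) measure) Y.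
        poisson_process P Y \<nu> \<and> distr M borel X = distr P borel (union_process Y))"

definition class_R :: "'w measure \<Rightarrow> ('w \<Rightarrow> ('a::countable \<Rightarrow> bool)) set" where
  "class_R M = {X. \<exists>\<nu>. distributed_as_X M X \<nu>}"


instance bool :: second_countable_topology
proof
  show "\<exists>B :: bool set set. countable B \<and> open = generate_topology B"
  proof (intro exI[of _ UNIV] conjI ext)
    show "open A = generate_topology UNIV A" for A :: "bool set"
      by (simp add: Topological_Spaces.open_discrete generate_topology.Basis)
  qed simp
qed


section \<open>Product measures and their mixtures\<close>

definition Pi_measure :: "real \<Rightarrow> (nat \<Rightarrow> bool) measure" where
  "Pi_measure p = PiM UNIV (\<lambda>_. measure_pmf (bernoulli_pmf p))"

text \<open>
  The measure \<open>c \<Sum>\<^sub>i \<delta>\<^bsub>{i}\<^esub> + \<integral> \<Pi>\<^sub>x d\<sigma>(x)\<close> on the nonempty subsets, for a measure \<open>\<sigma>\<close> on \<open>(0,1]\<close>.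
\<close>

definition mixture_intensity :: "real \<Rightarrow> real measure \<Rightarrow> (nat \<Rightarrow> bool) measure" where
  "mixture_intensity c \<sigma> =
     measure_of (space nonempty_subsets) (sets nonempty_subsets)
       (\<lambda>A. ennreal c * (\<Sum>i. emeasure (return nonempty_subsets (singleton_subset i)) A) +
            (\<integral>\<^sup>+ x. emeasure (Pi_measure x) A \<partial>\<sigma>))"

lemma sets_Pi_measure: "sets (Pi_measure p) = sets borel"
proof -
  have "sets (borel :: bool measure) = sets (count_space UNIV)"
    using sets_borel_eq_count_space by metis
  then have "sets (Pi_measure p) = sets (PiM UNIV (\<lambda>_::nat. borel :: bool measure))"
    unfolding Pi_measure_def by (intro sets_PiM_cong) auto
  then show ?thesis
    using sets_PiM_equal_borel[where 'a = nat and 'b = bool] by simp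
qed

lemma prob_space_Pi_measure: "prob_space (Pi_measure p)"
  unfolding Pi_measure_def by (intro prob_space_PiM prob_space_measure_pmf)

lemma measurable_Pi_measure: "Pi_measure \<in> measurable borel (prob_algebra borel)"
proof (rule measurable_prob_algebra_generated)
  let ?C = "\<lambda>_::nat. count_space (UNIV :: bool set)"
  show "sets (borel :: (nat \<Rightarrow> bool) measure) = sigma_sets UNIV (prod_algebra UNIV ?C)"
  proof -
    have "sets (Pi_measure 0) = sets (PiM UNIV ?C)"
      unfolding Pi_measure_def by (intro sets_PiM_cong) auto
    then show ?thesis
      by (simp add: sets_Pi_measure sets_PiM)
  qed
  show "Int_stable (prod_algebra UNIV ?C)"
    by (rule Int_stable_prod_algebra)
  show "prod_algebra UNIV ?C \<subseteq> Pow UNIV" by simp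
  show "prob_space (Pi_measure a)" for a by (rule prob_space_Pi_measure)
  show "sets (Pi_measure a) = sets borel" for a by (rule sets_Pi_measure)
  fix A assume "A \<in> prod_algebra UNIV ?C"
  then obtain J E where A: "A = prod_emb UNIV ?C J (\<Pi>\<^sub>E j\<in>J. E j)" and J: "finite J"
    by (elim prod_algebraE)
  have "emeasure (Pi_measure a) A = (\<Prod>j\<in>J. emeasure (measure_pmf (bernoulli_pmf a)) (E j))" for a
  proof -
    interpret product_prob_space "\<lambda>_::nat. measure_pmf (bernoulli_pmf a)" UNIV
      by (rule product_prob_spaceI) (rule prob_space_measure_pmf)
    have "A = prod_emb UNIV (\<lambda>_. measure_pmf (bernoulli_pmf a)) J (\<Pi>\<^sub>E j\<in>J. E j)"
      unfolding A prod_emb_def by simp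
    then show ?thesis
      unfolding Pi_measure_def using J by (simp add: emeasure_PiM_emb)
  qed
  moreover have "(\<lambda>a. emeasure (measure_pmf (bernoulli_pmf a)) B) \<in> borel_measurable borel"
    for B :: "bool set"
  proof -
    have "emeasure (measure_pmf (bernoulli_pmf a)) B =
        ennreal (\<Sum>b\<in>B. if b then min 1 (max 0 a) else 1 - min 1 (max 0 a))" for a
    proof -
      have "emeasure (measure_pmf (bernoulli_pmf a)) B = ennreal (\<Sum>b\<in>B. pmf (bernoulli_pmf a) b)"
        by (simp add: measure_pmf.emeasure_eq_measure measure_measure_pmf_finite)
      moreover have "pmf (bernoulli_pmf a) b = (if b then min 1 (max 0 a) else 1 - min 1 (max 0 a))"
        for b
        by (cases b) (simp_all add: bernoulli_pmf.rep_eq)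
      ultimately show ?thesis by simp
    qed
    then show ?thesis by simp
  qed
  ultimately show "(\<lambda>a. emeasure (Pi_measure a) A) \<in> borel_measurable borel"
    by simp
qed

lemma nonempty_subsets_in_borel: "{B :: nat \<Rightarrow> bool. \<exists>i. B i} \<in> sets borel"
proof -
  have "(\<lambda>B :: nat \<Rightarrow> bool. B i) \<in> measurable borel borel" for i
    by (intro borel_measurable_continuous_onI continuous_on_product_coordinates)
  then have "(\<lambda>B :: nat \<Rightarrow> bool. B i) -` {True} \<inter> space borel \<in> sets borel" for i
    by (rule measurable_sets) (simp add: borel_open Topological_Spaces.open_discrete)
  then have "(\<Union>i. (\<lambda>B :: nat \<Rightarrow> bool. B i) -` {True}) \<in> sets borel"
    by (intro sets.countable_UN) auto
  also have "(\<Union>i. (\<lambda>B :: nat \<Rightarrow> bool. B i) -` {True}) = {B. \<exists>i. B i}" by auto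
  finally show ?thesis .
qed

lemma emeasure_mixture_intensity:
  assumes \<sigma>: "sets \<sigma> = sets (restrict_space borel {0<..1})"
    and A: "A \<in> sets nonempty_subsets"
  shows "emeasure (mixture_intensity c \<sigma>) A =
    ennreal c * (\<Sum>i. indicator A (singleton_subset i)) + (\<integral>\<^sup>+ x. emeasure (Pi_measure x) A \<partial>\<sigma>)"
proof -
  let ?f = "\<lambda>A. ennreal c * (\<Sum>i. emeasure (return nonempty_subsets (singleton_subset i)) A) +
            (\<integral>\<^sup>+ x. emeasure (Pi_measure x) A \<partial>\<sigma>)"
  have borelD: "A \<in> sets borel" if "A \<in> sets nonempty_subsets" for A :: "(nat \<Rightarrow> bool) set"
    using that nonempty_subsets_in_borel
    by (auto simp: nonempty_subsets_def sets_restrict_space)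
  have meas: "(\<lambda>x. emeasure (Pi_measure x) A) \<in> borel_measurable \<sigma>"
    if "A \<in> sets nonempty_subsets" for A
  proof -
    have "(\<lambda>x. emeasure (Pi_measure x) A) \<in> borel_measurable borel"
      by (rule measurable_compose[OF measurable_prob_algebraD[OF measurable_Pi_measure]
            measurable_emeasure_subprob_algebra[OF borelD[OF that]]])
    then have "(\<lambda>x. emeasure (Pi_measure x) A) \<in> borel_measurable (restrict_space borel {0<..1})"
      by (rule measurable_restrict_space1)
    then show ?thesis using measurable_cong_sets[OF \<sigma> refl] by blast
  qed
  have "emeasure (mixture_intensity c \<sigma>) A = ?f A"
  proof (rule emeasure_measure_of[OF mixture_intensity_def])
    show "sets nonempty_subsets \<subseteq> Pow (space (nonempty_subsets :: (nat \<Rightarrow> bool) measure))"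
      by (rule sets.space_closed)
    show "A \<in> sets (mixture_intensity c \<sigma>)"
      using A by (simp add: mixture_intensity_def)
    show "positive (sets (mixture_intensity c \<sigma>)) ?f"
      by (simp add: positive_def)
    show "countably_additive (sets (mixture_intensity c \<sigma>)) ?f"
    proof (rule countably_additiveI)
      fix F :: "nat \<Rightarrow> (nat \<Rightarrow> bool) set"
      assume "range F \<subseteq> sets (mixture_intensity c \<sigma>)" and disj: "disjoint_family F"
      then have F: "F n \<in> sets nonempty_subsets" for n
        by (auto simp: mixture_intensity_def)
      have "(\<Sum>n. ?f (F n)) =
          ennreal c * (\<Sum>n i. emeasure (return nonempty_subsets (singleton_subset i)) (F n)) +
          (\<Sum>n. \<integral>\<^sup>+ x. emeasure (Pi_measure x) (F n) \<partial>\<sigma>)"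
        by (simp add: suminf_add[symmetric])
      also have "(\<Sum>n i. emeasure (return nonempty_subsets (singleton_subset i)) (F n)) =
          (\<Sum>i n. emeasure (return nonempty_subsets (singleton_subset i)) (F n))"
        using nn_integral_fst_count_space[of
            "\<lambda>(i, n). emeasure (return nonempty_subsets (singleton_subset i)) (F n)"]
          nn_integral_snd_count_space[of
            "\<lambda>(i, n). emeasure (return nonempty_subsets (singleton_subset i)) (F n)"]
        by (simp add: nn_integral_count_space_nat[symmetric])
      also have "\<dots> = (\<Sum>i. emeasure (return nonempty_subsets (singleton_subset i)) (\<Union>n. F n))"
        using F disj by (intro suminf_cong suminf_emeasure) auto
      also have "(\<Sum>n. \<integral>\<^sup>+ x. emeasure (Pi_measure x) (F n) \<partial>\<sigma>) =
          (\<integral>\<^sup>+ x. (\<Sum>n. emeasure (Pi_measure x) (F n)) \<partial>\<sigma>)"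
        using meas[OF F] by (rule nn_integral_suminf[symmetric])
      also have "\<dots> = (\<integral>\<^sup>+ x. emeasure (Pi_measure x) (\<Union>n. F n) \<partial>\<sigma>)"
        using borelD[OF F] disj
        by (intro nn_integral_cong suminf_emeasure) (auto simp: sets_Pi_measure)
      finally show "(\<Sum>n. ?f (F n)) = ?f (\<Union>n. F n)" .
    qed
  qed
  then show ?thesis using A by simp
qed


section \<open>Infinite divisibility\<close>

definition infinitely_divisible_real :: "real measure \<Rightarrow> bool" where
  "infinitely_divisible_real L \<longleftrightarrow>
     real_distribution L \<and>
     (\<forall>n::nat. n > 0 \<longrightarrow>
        (\<exists>K. real_distribution K \<and>
             L = distr (PiM {..<n} (\<lambda>_. K)) borel (\<lambda>z. \<Sum>i<n. z i)))"

text \<open>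
  For a law on \<open>[0,\<infinity>]\<close> (the type \<^typ>\<open>ennreal\<close>): it has the form
  \<open>p L' + (1 - p) \<delta>\<^sub>\<infinity>\<close> with \<open>p \<in> (0,1]\<close> and \<open>L'\<close> an infinitely divisible law on \<open>[0,\<infinity>)\<close>.
\<close>

definition infinitely_divisible :: "ennreal measure \<Rightarrow> bool" where
  "infinitely_divisible L \<longleftrightarrow>
     sets L = sets borel \<and>
     (\<exists>p L'. 0 < p \<and> p \<le> 1 \<and> infinitely_divisible_real L' \<and> (AE z in L'. 0 \<le> z) \<and>
        (\<forall>A\<in>sets borel. emeasure L A =
           ennreal p * emeasure (distr L' borel ennreal) A +
           ennreal (1 - p) * emeasure (return borel \<infinity>) A))"

text \<open>\<open>exp_neg t z\<close> is \<open>exp (- t z)\<close> for \<open>t > 0\<close> and \<open>z \<in> [0,\<infinity>]\<close>, with \<open>exp (- t \<infinity>) = 0\<close>.\<close>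

definition exp_neg :: "real \<Rightarrow> ennreal \<Rightarrow> real" where
  "exp_neg t z = (if z = \<infinity> then 0 else exp (- t * enn2real z))"

definition has_drift_and_Levy_measure ::
    "ennreal measure \<Rightarrow> real \<Rightarrow> ennreal measure \<Rightarrow> bool" where
  "has_drift_and_Levy_measure L \<gamma> \<rho> \<longleftrightarrow>
     0 \<le> \<gamma> \<and>
     sets \<rho> = sets (restrict_space borel {0<..}) \<and>
     (\<forall>\<epsilon>::real. 0 < \<epsilon> \<longrightarrow> emeasure \<rho> {ennreal \<epsilon><..} < \<infinity>) \<and>
     (\<integral>\<^sup>+ s \<in> {0<..1}. s \<partial>\<rho>) < \<infinity> \<and>
     (\<forall>t>0. (\<integral>z. exp_neg t z \<partial>L) = exp (- \<gamma> * t) * exp (\<integral>s. (exp_neg t s - 1) \<partial>\<rho>))"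


section \<open>The change of variables between [0,1] and [0,infinity]\<close>

definition phi :: "real \<Rightarrow> ennreal" where
  "phi x = (if x < 1 then ennreal (- ln (1 - x)) else \<infinity>)"

definition phi_inv :: "ennreal \<Rightarrow> real" where
  "phi_inv z = 1 - exp_neg 1 z"

lemma phi_inv_phi: "0 \<le> x \<Longrightarrow> x \<le> 1 \<Longrightarrow> phi_inv (phi x) = x"
  by (simp add: phi_def phi_inv_def exp_neg_def)

lemma phi_phi_inv: "phi (phi_inv z) = z"
  by (cases z) (simp_all add: phi_def phi_inv_def exp_neg_def)

end

theory Submission
  imports Defs
begin

text \<open>
  Avoidance probabilities link the two sides. If \<open>X\<close> is mixed Bernoulli with mixing law \<open>\<mu>\<close>, then for
  \<open>n\<close> indices the probability that \<open>X\<close> vanishes at all of them is \<open>\<integral> (1 - p)\<^sup>n d\<mu>(p) = E(exp (- n Z))\<close>;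
  for \<open>X\<^sup>\<nu>\<close> it is the probability that the Poisson process has no point hitting these indices, that
  is \<open>exp (- c n - \<integral> (1 - (1 - x)\<^sup>n) d\<sigma>(x))\<close>, the Levy-Khintchine formula at \<open>t = n\<close>. A law on \<open>[0,\<infinity>]\<close>
  is determined by its Laplace transform at the natural numbers, because these values are the moments
  of \<open>exp (- Z)\<close>, and a law on the subsets of \<open>\<nat>\<close> is determined by its avoidance probabilities.

  What remains is existence. A Poisson process with \<open>\<sigma>\<close>-finite intensity is a superposition of
  independent finite clusters with Poisson many i.i.d. points. Its Laplace functional gives both the
  defining properties of a Poisson process and, on summing the points of a Poisson process on
  \<open>(0,\<infinity>]\<close>, the infinitely divisible law with prescribed drift and Levy measure.
\<close>

section \<open>Laplace transforms on \<open>[0,\<infinity>]\<close>\<close>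

text \<open>Avoidance probabilities give the Laplace transform of \<open>Z\<close> at natural
  numbers only, whereas the Levy-Khintchine formula is required at every real \<open>t > 0\<close>.
  The formula is never extended from integers to reals: a law satisfying it for all \<open>t\<close>
  is built by summing Poisson points and is identified with the law of \<open>Z\<close> through its
  moments. The same device gives infinite divisibility: the root of order \<open>n\<close> is the
  law built from \<open>\<gamma> / n\<close> and \<open>\<rho> / n\<close>, while a mass of
  \<open>\<rho>\<close> at infinity is split off and determines the probability of an infinite
  value.

  The computations use nonnegative integrals of \<open>enexp\<close>, a version of
  \<open>exp (- z)\<close> with values in \<open>ennreal\<close>. Exponents may then be infinite, no
  integrability has to be carried along, and products such as \<open>t * z\<close> with
  \<open>z = \<infinity>\<close> follow the arithmetic of \<open>ennreal\<close>. For this reason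
  exponents are integrals of the nonnegative function \<open>1 - enexp\<close>, placed inside one
  \<open>enexp\<close>, rather than integrals of \<open>exp_neg t s - 1\<close>.\<close>

definition enexp :: "ennreal \<Rightarrow> ennreal" where
  "enexp z = ennreal (exp_neg 1 z)"

lemma exp_neg_bounds [simp]: "0 \<le> exp_neg t z" "0 \<le> t \<Longrightarrow> exp_neg t z \<le> 1"
  by (simp_all add: exp_neg_def)

lemma enexp_0 [simp]: "enexp 0 = 1"
  and enexp_top [simp]: "enexp \<top> = 0"
  and enexp_ennreal: "0 \<le> x \<Longrightarrow> enexp (ennreal x) = ennreal (exp (- x))"
  by (simp_all add: enexp_def exp_neg_def)

lemma enexp_le_1 [simp]: "enexp z \<le> 1"
  unfolding enexp_def using ennreal_leI[OF exp_neg_bounds(2)[of 1 z]] by simp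

lemma enexp_neq_top [simp]: "enexp z \<noteq> \<top>"
  by (simp add: enexp_def)

lemma enexp_eq_0_iff [simp]: "enexp z = 0 \<longleftrightarrow> z = \<top>"
  by (cases z) (simp_all add: enexp_ennreal)

lemma enexp_add: "enexp (a + b) = enexp a * enexp b"
  by (cases a; cases b)
    (simp_all add: enexp_ennreal exp_add[symmetric] ennreal_mult[symmetric] flip: ennreal_plus)

lemma enexp_sum: "enexp (\<Sum>i\<in>I. f i) = (\<Prod>i\<in>I. enexp (f i))"
  by (induction I rule: infinite_finite_induct) (simp_all add: enexp_add)

lemma enexp_of_nat_mult: "enexp (of_nat n * z) = enexp z ^ n"
  by (induction n) (simp_all add: distrib_right enexp_add)

lemma enexp_antimono: "a \<le> b \<Longrightarrow> enexp b \<le> enexp a"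
  by (cases a; cases b) (auto simp: enexp_ennreal ennreal_le_iff top_unique)

lemma enexp_inj: "enexp a = enexp b \<longleftrightarrow> a = b"
  by (cases a; cases b) (auto simp: enexp_ennreal)

lemma exp_neg_measurable [measurable]: "exp_neg t \<in> borel_measurable borel"
  unfolding exp_neg_def[abs_def] by measurable

lemma enexp_measurable [measurable]: "enexp \<in> borel_measurable borel"
  unfolding enexp_def[abs_def] by measurable

lemma phi_measurable [measurable]: "phi \<in> borel_measurable borel"
  unfolding phi_def[abs_def] by measurable

lemma phi_inv_measurable [measurable]: "phi_inv \<in> borel_measurable borel"
  unfolding phi_inv_def[abs_def] by measurable

lemma exp_neg_eq_enexp: "0 < t \<Longrightarrow> exp_neg t z = enn2real (enexp (ennreal t * z))"
  by (cases z) (simp_all add: exp_neg_def enexp_ennreal ennreal_mult_top flip: ennreal_mult)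

lemma tendsto_enexp:
  assumes f: "(f \<longlongrightarrow> z) F" shows "((\<lambda>x. enexp (f x)) \<longlongrightarrow> enexp z) F"
proof (cases z)
  case (real r)
  have "((\<lambda>x. ennreal (exp (- enn2real (f x)))) \<longlongrightarrow> ennreal (exp (- enn2real z))) F"
    using f real by (intro tendsto_intros) auto
  \<comment> \<open>\<open>enn2real\<close> sends \<open>\<infinity>\<close> to 0, so the formula
    above agrees with \<open>enexp (f x)\<close> only where \<open>f x\<close> is finite.\<close>
  moreover have "\<forall>\<^sub>F x in F. f x < \<top>"
    using f real by (intro order_tendstoD(2)[OF f]) auto
  ultimately show ?thesis
    using real by (auto simp: enexp_def exp_neg_def elim!: eventually_mono intro: Lim_transform_eventually)
next
  case top
  show ?thesis
  proof (rule order_tendstoI)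
    fix e assume "enexp z < e"
    then have "e > 0" using top by simp
    then obtain d where d: "0 < d" "ennreal d < e"
      by (metis dense ennreal_cases ennreal_less_zero_iff less_top_ennreal order.strict_trans2 top_greatest)
    have "\<forall>\<^sub>F x in F. ennreal (max 0 (- ln d)) < f x"
      using f top by (intro order_tendstoD(1)) auto
    then show "\<forall>\<^sub>F x in F. enexp (f x) < e"
    proof eventually_elim
      case (elim x)
      then have "enexp (f x) \<le> ennreal (exp (- max 0 (- ln d)))"
        using enexp_antimono[OF less_imp_le[OF elim]] by (simp only: enexp_ennreal max.cobounded1)
      also have "\<dots> \<le> ennreal (exp (ln d))"
        by (intro ennreal_leI) simp
      finally show ?case using d by simp
    qed
  qed (use top in simp)
qed

text \<open>Continuity on \<open>[0,\<infinity>]\<close> turns the sum into an infinite product even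
  when the sum diverges. The limit is written as an infimum because monotone convergence for
  decreasing integrands later exchanges it with an integral.\<close>

lemma enexp_suminf: "enexp (\<Sum>k. a k) = (INF n. \<Prod>k<n. enexp (a k))"
proof -
  have "(\<lambda>n. enexp (\<Sum>k<n. a k)) \<longlonglongrightarrow> enexp (\<Sum>k. a k)"
    by (intro tendsto_enexp summable_LIMSEQ) simp
  moreover have "decseq (\<lambda>n. enexp (\<Sum>k<n. a k))"
    by (intro antimonoI enexp_antimono sum_mono2) auto
  ultimately show ?thesis
    using LIMSEQ_unique[OF LIMSEQ_INF] by (metis (mono_tags, lifting) INF_cong enexp_sum)
qed

section \<open>Uniqueness of measures with given moments\<close>

lemma moments_unit_interval_unique:
  fixes M N :: "real measure"
  assumes "real_distribution M" "real_distribution N"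
    and "AE x in M. x \<in> {0..1}" "AE x in N. x \<in> {0..1}"
    and moments: "\<And>n::nat. (\<integral>x. x ^ n \<partial>M) = (\<integral>x. x ^ n \<partial>N)"
  shows "M = N"
proof -
  \<comment> \<open>The characteristic function is a power series in the moments. On
    \<open>[0,1]\<close> all moments are at most 1, so the series is dominated by an exponential
    series and sum and integral may be exchanged.\<close>
  have char: "(\<lambda>n. (\<i> * complex_of_real t) ^ n / fact n * complex_of_real (\<integral>x. x ^ n \<partial>M)) sums char M t"
    if "real_distribution M" and ae: "AE x in M. x \<in> {0..1}" for M t
  proof -
    interpret real_distribution M by fact
    have norm: "AE x in M. norm (x ^ n) \<le> 1" for n :: nat
      using ae by eventually_elim (auto simp: power_le_one)
    have int: "integrable M (\<lambda>x. x ^ n)" for n :: nat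
      using norm by (intro integrable_const_bound[where B = 1]) auto
    let ?f = "\<lambda>n x. (\<i> * complex_of_real t) ^ n / fact n * complex_of_real (x ^ n)"
    have "(\<lambda>n. integral\<^sup>L M (?f n)) sums (\<integral>x. (\<Sum>n. ?f n x) \<partial>M)"
    proof (rule sums_integral)
      show "integrable M (?f n)" for n
        using int[of n] by (intro integrable_mult_right integrable_of_real)
      show "AE x in M. summable (\<lambda>n. norm (?f n x))"
      proof (rule AE_I2)
        fix x show "summable (\<lambda>n. norm (?f n x))"
          using summable_norm_exp[of "\<i> * complex_of_real t * complex_of_real x"]
          by (simp add: norm_mult norm_power norm_divide power_mult_distrib divide_simps scaleR_conv_of_real)
      qed
      have "norm (\<integral>x. norm (?f n x) \<partial>M) \<le> norm (t ^ n /\<^sub>R fact n)" for n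
      proof -
        have "(\<integral>x. norm (?f n x) \<partial>M) \<le> (\<integral>x. \<bar>t\<bar> ^ n / fact n \<partial>M)"
        proof (rule integral_mono_AE)
          show "AE x in M. norm (?f n x) \<le> \<bar>t\<bar> ^ n / fact n"
            using norm[of n] by eventually_elim
              (auto simp: norm_mult norm_power norm_divide divide_simps abs_mult power_abs mult_left_le)
          show "integrable M (\<lambda>x. norm (?f n x))"
            using int[of n] by (intro integrable_norm integrable_mult_right integrable_of_real)
        qed auto
        also have "\<dots> = \<bar>t\<bar> ^ n / fact n"
          by (simp add: prob_space del: space_eq_univ)
        finally show ?thesis
          by (simp add: integral_nonneg_AE power_abs abs_mult divide_inverse mult.commute)
      qed
      then show "summable (\<lambda>n. \<integral>x. norm (?f n x) \<partial>M)"
        by (intro summable_comparison_test[OF _ summable_norm_exp[of t]]) blast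
    qed
    moreover have "integral\<^sup>L M (?f n) = (\<i> * complex_of_real t) ^ n / fact n * complex_of_real (\<integral>x. x ^ n \<partial>M)" for n
      by (simp only: integral_mult_right_zero integral_complex_of_real)
    moreover have "(\<Sum>n. ?f n x) = iexp (t * x)" for x
      by (simp add: exp_def power_mult_distrib divide_simps scaleR_conv_of_real ac_simps)
    ultimately show ?thesis unfolding char_def by (simp only:)
  qed
  have "char M t = char N t" for t
    using sums_unique2[OF char[OF assms(1,3)]] char[OF assms(2,4)] moments by simp
  then show ?thesis by (intro Levy_uniqueness assms ext)
qed

lemma AE_scale_measureI: "AE x in M. P x \<Longrightarrow> AE x in scale_measure r M. P x"
  by (auto simp: eventually_ae_filter null_sets_def space_scale_measure)

text \<open>The zeroth moments fix a common total mass, and dividing by it reduces the claim to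
  probability measures; mass 0 cannot be normalized and is treated apart. Measures of other mass
  occur below as weighted laws and weighted Levy measures.\<close>

lemma finite_measure_unit_interval_unique:
  fixes M N :: "real measure"
  assumes "finite_measure M" "finite_measure N" "sets M = sets borel" "sets N = sets borel"
    and "AE x in M. x \<in> {0..1}" "AE x in N. x \<in> {0..1}"
    and moments: "\<And>n::nat. (\<integral>\<^sup>+x. ennreal x ^ n \<partial>M) = (\<integral>\<^sup>+x. ennreal x ^ n \<partial>N)"
  shows "M = N"
proof -
  have tot: "emeasure M UNIV = emeasure N UNIV"
    using moments[of 0] assms(3,4)[THEN sets_eq_imp_space_eq] by simp
  show ?thesis
  proof (cases "emeasure M UNIV = 0")
    case True
    show ?thesis
    proof (rule measure_eqI)
      show "sets M = sets N" using assms by simp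
      fix A assume "A \<in> sets M"
      then show "emeasure M A = emeasure N A"
        using True tot emeasure_mono[of A UNIV M] emeasure_mono[of A UNIV N] assms(3,4) by simp
    qed
  next
    case False
    then obtain m where m: "0 < m" "emeasure M UNIV = ennreal m"
      using finite_measure.emeasure_finite[OF assms(1), of UNIV]
      by (cases "emeasure M UNIV") (auto simp: less_le)
    define r where "r = ennreal (1 / m)"
    have r: "r \<noteq> 0" "r * emeasure M UNIV = 1" "emeasure M UNIV * r = 1"
      using m by (auto simp: r_def simp flip: ennreal_mult)
    have sc: "real_distribution (scale_measure r M)"
      if "sets M = sets borel" "r * emeasure M UNIV = 1" for M :: "real measure"
    proof -
      have "space M = UNIV" using sets_eq_imp_space_eq[OF that(1)] by simp
      then have "prob_space (scale_measure r M)"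
        by (intro prob_spaceI) (simp add: space_scale_measure that)
      then show ?thesis
        by (simp add: real_distribution_def real_distribution_axioms_def that)
    qed
    have "scale_measure r M = scale_measure r N"
    proof (rule moments_unit_interval_unique)
      fix n :: nat
      have *: "(\<integral>x. x ^ n \<partial>scale_measure r M) = enn2real (r * (\<integral>\<^sup>+x. ennreal x ^ n \<partial>M))"
        if "sets M = sets borel" "AE x in M. x \<in> {0..1}" for M :: "real measure"
      proof -
        have [measurable_cong]: "sets M = sets borel" by fact
        have ae: "AE x in scale_measure r M. x \<in> {0..1}"
          using that(2) by (rule AE_scale_measureI)
        have "(\<integral>x. x ^ n \<partial>scale_measure r M) = enn2real (\<integral>\<^sup>+x. ennreal (x ^ n) \<partial>scale_measure r M)"
          using ae by (intro integral_eq_nn_integral) (auto elim: eventually_mono)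
        also have "(\<integral>\<^sup>+x. ennreal (x ^ n) \<partial>scale_measure r M) = r * (\<integral>\<^sup>+x. ennreal (x ^ n) \<partial>M)"
          by (rule nn_integral_scale_measure) measurable
        also have "(\<integral>\<^sup>+x. ennreal (x ^ n) \<partial>M) = (\<integral>\<^sup>+x. ennreal x ^ n \<partial>M)"
          using that(2) by (intro nn_integral_cong_AE) (auto elim!: eventually_mono simp: ennreal_power)
        finally show ?thesis .
      qed
      show "(\<integral>x. x ^ n \<partial>scale_measure r M) = (\<integral>x. x ^ n \<partial>scale_measure r N)"
        using *[of M] *[of N] moments[of n] assms by simp
    qed (use assms r tot sc in \<open>auto intro: AE_scale_measureI\<close>)
    then have "scale_measure (emeasure M UNIV) (scale_measure r M) = scale_measure (emeasure M UNIV) (scale_measure r N)"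
      by simp
    then show ?thesis by (simp add: scale_scale_measure r)
  qed
qed

text \<open>The map \<open>exp_neg 1\<close> sends \<open>[0,\<infinity>]\<close> injectively into
  the unit interval, with left inverse \<open>phi (1 - u)\<close>, so the hypothesis compares
  ordinary moments of the image measures.\<close>

theorem enexp_moments_unique:
  fixes L1 L2 :: "ennreal measure"
  assumes L1: "finite_measure L1" "sets L1 = sets borel"
    and L2: "finite_measure L2" "sets L2 = sets borel"
    and moments: "\<And>n::nat. (\<integral>\<^sup>+z. enexp z ^ n \<partial>L1) = (\<integral>\<^sup>+z. enexp z ^ n \<partial>L2)"
  shows "L1 = L2"
proof -
  have phi_distr: "distr (distr L borel (exp_neg 1)) borel (\<lambda>u. phi (1 - u)) = L"
    if sets_L: "sets L = sets borel" for L :: "ennreal measure"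
  proof -
    have [measurable_cong]: "sets L = sets borel" by (rule sets_L)
    have "phi (1 - exp_neg 1 z) = z" for z using phi_phi_inv[of z] by (simp add: phi_inv_def)
    then show ?thesis using sets_L by (simp add: distr_distr comp_def distr_id2)
  qed
  have [measurable_cong]: "sets L1 = sets borel" "sets L2 = sets borel" by fact+
  have "distr L1 borel (exp_neg 1) = distr L2 borel (exp_neg 1)"
    by (rule finite_measure_unit_interval_unique)
      (use moments in \<open>auto simp: AE_distr_iff nn_integral_distr enexp_def intro!: finite_measure.finite_measure_distr L1 L2\<close>)
  then show ?thesis using phi_distr[OF L1(2)] phi_distr[OF L2(2)] by metis
qed

text \<open>Only the coordinates in the finite set \<open>J\<close> enter the integrand, so the
  infinite product is projected to \<open>J\<close>, where Fubini applies.\<close>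

lemma nn_integral_PiM_prod:
  fixes f :: "'i \<Rightarrow> 'a \<Rightarrow> ennreal"
  assumes M: "\<And>i. prob_space (M i)" and J: "finite J"
    and f: "\<And>i. i \<in> J \<Longrightarrow> f i \<in> borel_measurable (M i)"
  shows "(\<integral>\<^sup>+\<omega>. (\<Prod>i\<in>J. f i (\<omega> i)) \<partial>PiM UNIV M) = (\<Prod>i\<in>J. \<integral>\<^sup>+x. f i x \<partial>M i)"
proof -
  interpret P: product_prob_space M UNIV by (rule product_prob_spaceI) (rule M)
  have [measurable]: "i \<in> J \<Longrightarrow> f i \<in> borel_measurable (M i)" for i by fact
  have "(\<Prod>i\<in>J. \<integral>\<^sup>+x. f i x \<partial>M i) = (\<integral>\<^sup>+\<omega>. (\<Prod>i\<in>J. f i (\<omega> i)) \<partial>PiM J M)"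
    using J f by (rule P.product_nn_integral_prod[symmetric])
  also have "\<dots> = (\<integral>\<^sup>+\<omega>. (\<Prod>i\<in>J. f i (\<omega> i)) \<partial>distr (PiM UNIV M) (PiM J M) (\<lambda>x. restrict x J))"
    using J by (simp add: P.distr_PiM_restrict_finite)
  also have "\<dots> = (\<integral>\<^sup>+\<omega>. (\<Prod>i\<in>J. f i (\<omega> i)) \<partial>PiM UNIV M)"
    using J by (subst nn_integral_distr) (auto intro!: nn_integral_cong)
  finally show ?thesis by simp
qed

section \<open>Poisson processes\<close>

text \<open>The integral of \<open>f\<close> against the counting measure of the family,
  multiplicities included. As \<open>f\<close> varies, the expectation of
  \<open>enexp (point_sum f y)\<close> is the Laplace functional of the point process.\<close>

definition point_sum :: "('e \<Rightarrow> ennreal) \<Rightarrow> (nat \<Rightarrow> 'e option) \<Rightarrow> ennreal" where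
  "point_sum f y = (\<Sum>i. case y i of None \<Rightarrow> 0 | Some b \<Rightarrow> f b)"

lemma num_points_eq_point_sum: "num_points y A = point_sum (indicator A) y"
proof -
  have "num_points y A = (\<integral>\<^sup>+i. indicator {j. \<exists>b\<in>A. y j = Some b} i \<partial>count_space UNIV)"
    unfolding num_points_def by simp
  also have "\<dots> = (\<Sum>i. indicator {j. \<exists>b\<in>A. y j = Some b} i)"
    by (rule nn_integral_count_space_nat)
  also have "\<dots> = point_sum (indicator A) y"
    unfolding point_sum_def by (intro suminf_cong) (auto split: option.split split_indicator)
  finally show ?thesis .
qed

lemma point_sum_sum:
  "point_sum (\<lambda>x. \<Sum>i\<in>I. f i x) y = (\<Sum>i\<in>I. point_sum (f i) y)"
proof -
  have "point_sum (\<lambda>x. \<Sum>i\<in>I. f i x) y = (\<Sum>j. \<Sum>i\<in>I. case y j of None \<Rightarrow> 0 | Some b \<Rightarrow> f i b)"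
    unfolding point_sum_def by (intro suminf_cong) (auto split: option.split)
  then show ?thesis
    by (simp add: point_sum_def suminf_sum[symmetric])
qed

lemma point_sum_cmult: "point_sum (\<lambda>x. c * f x) y = c * point_sum f y"
proof -
  have "point_sum (\<lambda>x. c * f x) y = (\<Sum>j. c * (case y j of None \<Rightarrow> 0 | Some b \<Rightarrow> f b))"
    unfolding point_sum_def by (intro suminf_cong) (auto split: option.split)
  then show ?thesis by (simp add: point_sum_def)
qed

text \<open>Unlike \<^const>\<open>poisson_pmf\<close>, this allows the rate \<open>0\<close>.\<close>

definition pois :: "real \<Rightarrow> nat pmf" where
  "pois r = (if r = 0 then return_pmf 0 else poisson_pmf r)"

lemma pmf_pois: "0 \<le> r \<Longrightarrow> pmf (pois r) k = r ^ k / fact k * exp (- r)"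
  by (cases k) (auto simp: pois_def)

text \<open>This is the probability generating function of the Poisson law. Evaluated at
  \<open>u = \<integral> exp (- f)\<close> it produces the exponent
  \<open>\<integral> (1 - exp (- f))\<close> of the Laplace functional.\<close>

lemma nn_integral_pois:
  assumes r: "0 \<le> r" and u: "u \<le> 1"
  shows "(\<integral>\<^sup>+n. u ^ n \<partial>measure_pmf (pois r)) = enexp (ennreal r * (1 - u))"
proof -
  obtain v where v: "u = ennreal v" "0 \<le> v" "v \<le> 1"
    using u by (cases u) (auto simp: top_unique)
  have "(\<integral>\<^sup>+n. u ^ n \<partial>measure_pmf (pois r)) = (\<Sum>n. ennreal (exp (- r) * ((r * v) ^ n /\<^sub>R fact n)))"
    unfolding nn_integral_measure_pmf nn_integral_count_space_nat using r v
    by (intro suminf_cong)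
      (simp add: pmf_pois ennreal_power ennreal_mult[symmetric] power_mult_distrib divide_inverse ac_simps)
  also have "\<dots> = ennreal (exp (- r) * exp (r * v))"
  proof (rule suminf_ennreal_eq)
    show "(\<lambda>n. exp (- r) * ((r * v) ^ n /\<^sub>R fact n)) sums (exp (- r) * exp (r * v))"
      by (intro sums_mult exp_converges)
  qed (use r v in simp)
  also have "\<dots> = enexp (ennreal (r * (1 - v)))"
    using r v by (subst enexp_ennreal) (auto simp: exp_add[symmetric] algebra_simps mult_left_le)
  finally show ?thesis
    using r v by (simp add: ennreal_mult ennreal_minus[symmetric])
qed

section \<open>Superposition of Poisson clusters\<close>

definition cluster_space :: "(nat \<Rightarrow> real) \<Rightarrow> (nat \<Rightarrow> 'e measure) \<Rightarrow> (nat \<Rightarrow> nat \<times> (nat \<Rightarrow> 'e)) measure" where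
  "cluster_space r M = PiM UNIV (\<lambda>k. measure_pmf (pois (r k)) \<Otimes>\<^sub>M PiM UNIV (\<lambda>_. M k))"

definition cluster_points :: "(nat \<Rightarrow> nat \<times> (nat \<Rightarrow> 'e)) \<Rightarrow> nat \<Rightarrow> 'e option" where
  "cluster_points \<omega> i = (case prod_decode i of (k, j) \<Rightarrow>
     if j < fst (\<omega> k) then Some (snd (\<omega> k) j) else None)"

lemma prob_space_cluster:
  "prob_space M \<Longrightarrow> prob_space (measure_pmf (pois r) \<Otimes>\<^sub>M PiM UNIV (\<lambda>_::nat. M))"
  by (intro prob_space_pair prob_space_PiM prob_space_measure_pmf)

lemma prob_space_cluster_space:
  "(\<And>k. prob_space (M k)) \<Longrightarrow> prob_space (cluster_space r M)"
  unfolding cluster_space_def by (intro prob_space_PiM prob_space_cluster)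

lemma point_sum_cluster_points:
  "point_sum f (cluster_points \<omega>) = (\<Sum>k. \<Sum>j. if j < fst (\<omega> k) then f (snd (\<omega> k) j) else 0)"
proof -
  let ?g = "\<lambda>(k, j). if j < fst (\<omega> k) then f (snd (\<omega> k) j) else 0"
  have "point_sum f (cluster_points \<omega>) = (\<Sum>i. ?g (prod_decode i))"
    unfolding point_sum_def cluster_points_def by (intro suminf_cong) (auto split: prod.split)
  then show ?thesis by (simp add: suminf_ennreal_2dimen[where f = ?g, OF refl])
qed

lemma measurable_point_sum_cluster_points:
  assumes [measurable]: "f \<in> borel_measurable N" and M: "\<And>k. sets (M k) = sets N"
  shows "(\<lambda>\<omega>. point_sum f (cluster_points \<omega>)) \<in> borel_measurable (cluster_space r M)"
proof -
  have [measurable_cong]: "\<And>k. sets (M k) = sets N" by (rule M)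
  show ?thesis
    unfolding point_sum_cluster_points cluster_space_def by measurable
qed

text \<open>Distinct clusters are independent, so their Laplace functionals multiply. Inside cluster
  \<open>k\<close>, conditioning on the number \<open>m\<close> of points gives the power
  \<open>m\<close> of \<open>\<integral> exp (- f)\<close>, and the Poisson generating function sums
  these powers.\<close>

theorem Laplace_functional_cluster_points:
  fixes f :: "'e \<Rightarrow> ennreal"
  assumes r: "\<And>k. 0 \<le> r k" and M: "\<And>k. prob_space (M k)" "\<And>k. sets (M k) = sets N"
    and f [measurable]: "f \<in> borel_measurable N"
  shows "(\<integral>\<^sup>+\<omega>. enexp (point_sum f (cluster_points \<omega>)) \<partial>cluster_space r M) =
    enexp (\<Sum>k. ennreal (r k) * (\<integral>\<^sup>+x. 1 - enexp (f x) \<partial>M k))"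
proof -
  have [measurable_cong]: "\<And>k. sets (M k) = sets N" by (rule M)
  let ?C = "\<lambda>k. measure_pmf (pois (r k)) \<Otimes>\<^sub>M PiM UNIV (\<lambda>_::nat. M k)"
  define g :: "nat \<times> (nat \<Rightarrow> 'e) \<Rightarrow> ennreal"
    where "g z = enexp (\<Sum>j. if j < fst z then f (snd z j) else 0)" for z
  have g_meas [measurable]: "g \<in> borel_measurable (?C k)" for k
    unfolding g_def by measurable
  have g_le: "g z \<le> 1" for z by (simp add: g_def)
  have g_eq: "g (m, x) = (\<Prod>j<m. enexp (f (x j)))" for m x
  proof -
    have "(\<Sum>j. if j < m then f (x j) else 0) = (\<Sum>j<m. f (x j))"
      by (subst suminf_finite[of "{..<m}"]) auto
    then show ?thesis by (simp only: g_def fst_conv snd_conv enexp_sum)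
  qed
  have int_g: "(\<integral>\<^sup>+z. g z \<partial>?C k) = enexp (ennreal (r k) * (\<integral>\<^sup>+x. 1 - enexp (f x) \<partial>M k))" for k
  proof -
    interpret Mk: prob_space "M k" by (rule M)
    interpret PM: prob_space "PiM UNIV (\<lambda>_::nat. M k)" by (intro prob_space_PiM M)
    have le: "(\<integral>\<^sup>+x. enexp (f x) \<partial>M k) \<le> 1"
      using nn_integral_mono[of "M k" "\<lambda>x. enexp (f x)" "\<lambda>_. 1"] by (simp add: Mk.emeasure_space_1)
    have "(\<integral>\<^sup>+z. g z \<partial>?C k) = (\<integral>\<^sup>+m. \<integral>\<^sup>+x. g (m, x) \<partial>PiM UNIV (\<lambda>_. M k) \<partial>measure_pmf (pois (r k)))"
      by (rule PM.nn_integral_fst[symmetric]) measurable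
    also have "\<dots> = (\<integral>\<^sup>+m. (\<integral>\<^sup>+x. enexp (f x) \<partial>M k) ^ m \<partial>measure_pmf (pois (r k)))"
      unfolding g_eq by (subst nn_integral_PiM_prod) (auto intro: M)
    also have "\<dots> = enexp (ennreal (r k) * (1 - (\<integral>\<^sup>+x. enexp (f x) \<partial>M k)))"
      by (rule nn_integral_pois) (use r le in auto)
    also have "1 - (\<integral>\<^sup>+x. enexp (f x) \<partial>M k) = (\<integral>\<^sup>+x. 1 - enexp (f x) \<partial>M k)"
      using le by (subst nn_integral_diff) (auto simp: Mk.emeasure_space_1 top_unique)
    finally show ?thesis .
  qed
  have "(\<integral>\<^sup>+\<omega>. enexp (point_sum f (cluster_points \<omega>)) \<partial>cluster_space r M) =
      (\<integral>\<^sup>+\<omega>. (INF n. \<Prod>k<n. g (\<omega> k)) \<partial>PiM UNIV ?C)"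
    unfolding point_sum_cluster_points enexp_suminf cluster_space_def g_def ..
  \<comment> \<open>Every factor is at most 1, so the partial products decrease; the empty product
    supplies the finite integral at \<open>n = 0\<close>.\<close>
  also have "\<dots> = (INF n. \<integral>\<^sup>+\<omega>. (\<Prod>k<n. g (\<omega> k)) \<partial>PiM UNIV ?C)"
  proof (rule nn_integral_monotone_convergence_INF_AE)
    show "(\<integral>\<^sup>+\<omega>. (\<Prod>k<0. g (\<omega> k)) \<partial>PiM UNIV ?C) < \<infinity>"
      using prob_space_cluster_space[OF M(1), of r]
      by (simp add: prob_space.emeasure_space_1 cluster_space_def)
  qed (auto intro!: AE_I2 mult_left_le g_le)
  also have "\<dots> = (INF n. \<Prod>k<n. \<integral>\<^sup>+z. g z \<partial>?C k)"
    by (intro INF_cong refl nn_integral_PiM_prod prob_space_cluster M) auto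
  also have "\<dots> = enexp (\<Sum>k. ennreal (r k) * (\<integral>\<^sup>+x. 1 - enexp (f x) \<partial>M k))"
    unfolding int_g enexp_suminf ..
  finally show ?thesis .
qed

text \<open>Along a disjoint partition into pieces of finite mass, \<open>r k\<close> is the mass of
  a piece and \<open>M k\<close> the measure conditioned on it. Conditioning on a null piece is
  impossible, so a Dirac measure at \<open>x0\<close> stands in, with weight 0.\<close>

lemma sigma_finite_decomposition:
  assumes "sigma_finite_measure \<nu>" and x0: "x0 \<in> space \<nu>"
  obtains r :: "nat \<Rightarrow> real" and M where "\<And>k. 0 \<le> r k" "\<And>k. prob_space (M k)" "\<And>k. sets (M k) = sets \<nu>"
    "\<And>f. f \<in> borel_measurable \<nu> \<Longrightarrow> (\<integral>\<^sup>+x. f x \<partial>\<nu>) = (\<Sum>k. ennreal (r k) * (\<integral>\<^sup>+x. f x \<partial>M k))"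
proof -
  interpret sigma_finite_measure \<nu> by fact
  obtain F :: "nat \<Rightarrow> _" where F: "range F \<subseteq> sets \<nu>" "(\<Union>i. F i) = space \<nu>"
    "\<And>i. emeasure \<nu> (F i) \<noteq> \<infinity>" "disjoint_family F"
    using sigma_finite_disjoint by blast
  have [measurable]: "F k \<in> sets \<nu>" for k using F(1) by auto
  define r where "r k = measure \<nu> (F k)" for k
  define M where "M k = (if emeasure \<nu> (F k) = 0 then return \<nu> x0 else uniform_measure \<nu> (F k))" for k
  have r: "ennreal (r k) = emeasure \<nu> (F k)" for k
    unfolding r_def using F(3)[of k] by (simp add: emeasure_eq_ennreal_measure)
  show thesis
  proof (rule that)
    show "0 \<le> r k" for k by (simp add: r_def)
    show "prob_space (M k)" for k
      using F(3)[of k] x0 by (auto simp: M_def intro!: prob_space_return prob_space_uniform_measure)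
    show "sets (M k) = sets \<nu>" for k by (simp add: M_def)
    fix f :: "_ \<Rightarrow> ennreal" assume [measurable]: "f \<in> borel_measurable \<nu>"
    have piece: "ennreal (r k) * (\<integral>\<^sup>+x. f x \<partial>M k) = (\<integral>\<^sup>+x. f x * indicator (F k) x \<partial>\<nu>)" for k
    proof (cases "emeasure \<nu> (F k) = 0")
      case True
      then show ?thesis
        by (simp add: r nn_integral_null_set null_sets_def)
    next
      case False
      then show ?thesis
        using F(3)[of k] by (simp add: r M_def nn_integral_uniform_measure ennreal_times_divide
            mult.commute[of "emeasure \<nu> (F k)"] mult_divide_eq_ennreal)
    qed
    have "(\<integral>\<^sup>+x. f x \<partial>\<nu>) = (\<integral>\<^sup>+x. (\<Sum>k. f x * indicator (F k) x) \<partial>\<nu>)"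
      using F by (intro nn_integral_cong)
        (simp add: suminf_indicator)
    also have "\<dots> = (\<Sum>k. \<integral>\<^sup>+x. f x * indicator (F k) x \<partial>\<nu>)"
      by (rule nn_integral_suminf) measurable
    finally show "(\<integral>\<^sup>+x. f x \<partial>\<nu>) = (\<Sum>k. ennreal (r k) * (\<integral>\<^sup>+x. f x \<partial>M k))"
      by (simp add: piece)
  qed
qed

text \<open>
  The powers \<open>enexp (X i) ^ n i\<close> are replaced by indicators one index at a time; each replacement
  applies \<open>enexp_moments_unique\<close> to the law of \<open>X j\<close> weighted by the remaining factors.
\<close>

lemma (in prob_space) indep_vars_enexpI:
  fixes X :: "'i \<Rightarrow> 'a \<Rightarrow> ennreal"
  assumes I: "finite I" and X: "\<And>i. i \<in> I \<Longrightarrow> X i \<in> borel_measurable M"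
    and moments: "\<And>n :: 'i \<Rightarrow> nat. (\<integral>\<^sup>+\<omega>. (\<Prod>i\<in>I. enexp (X i \<omega>) ^ n i) \<partial>M) =
      (\<Prod>i\<in>I. \<integral>\<^sup>+\<omega>. enexp (X i \<omega>) ^ n i \<partial>M)"
  shows "indep_vars (\<lambda>_. borel) X I"
proof -
  have [measurable]: "i \<in> I \<Longrightarrow> X i \<in> borel_measurable M" for i by (rule X)
  have product: "prob (\<Inter>i\<in>I. X i -` B i \<inter> space M) = (\<Prod>i\<in>I. prob (X i -` B i \<inter> space M))"
    if ne: "I \<noteq> {}" and B: "\<And>i. i \<in> I \<Longrightarrow> B i \<in> sets borel" for B
  proof -
    have [measurable]: "i \<in> I \<Longrightarrow> B i \<in> sets borel" for i by (rule B)
    \<comment> \<open>Indices in \<open>J\<close> already carry indicators, the others still carry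
      powers. \<open>J = {}\<close> is the hypothesis on moments, \<open>J = I\<close> the product
      formula for events.\<close>
    define h :: "('i \<Rightarrow> nat) \<Rightarrow> 'i set \<Rightarrow> 'i \<Rightarrow> 'a \<Rightarrow> ennreal"
      where "h n J i \<omega> = (if i \<in> J then indicator (B i) (X i \<omega>) else enexp (X i \<omega>) ^ n i)" for n J i \<omega>
    have h_meas [measurable]: "i \<in> I \<Longrightarrow> h n J i \<in> borel_measurable M" for n J i
      unfolding h_def[abs_def] by (cases "i \<in> J") simp_all
    have h_le: "h n J i \<omega> \<le> 1" for n J i \<omega>
      by (auto simp: h_def power_le_one split: split_indicator)
    have "(\<integral>\<^sup>+\<omega>. (\<Prod>i\<in>I. h n J i \<omega>) \<partial>M) = (\<Prod>i\<in>I. \<integral>\<^sup>+\<omega>. h n J i \<omega> \<partial>M)"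
      if "J \<subseteq> I" for n J
      using finite_subset[OF that I] that
    \<comment> \<open>The exponents stay arbitrary because the step applies the induction hypothesis
      with every power \<open>m\<close> of \<open>enexp (X j)\<close> in turn.\<close>
    proof (induction J arbitrary: n rule: finite_induct)
      case empty
      show ?case using moments[of n] by (simp add: h_def)
    next
      case (insert j J)
      then have j: "j \<in> I" "j \<notin> J" and J: "J \<subseteq> I" by auto
      define R where "R \<omega> = (\<Prod>i\<in>I - {j}. h n J i \<omega>)" for \<omega>
      define c where "c = (\<Prod>i\<in>I - {j}. \<integral>\<^sup>+\<omega>. h n J i \<omega> \<partial>M)"
      have [measurable]: "X j \<in> borel_measurable M" "B j \<in> sets borel" using j by auto
      have R_meas [measurable]: "R \<in> borel_measurable M"
        unfolding R_def by measurable
      have R_le: "R \<omega> \<le> 1" for \<omega>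
        unfolding R_def by (intro prod_le_1 conjI h_le) simp
      have "(\<integral>\<^sup>+\<omega>. h n J i \<omega> \<partial>M) \<le> 1" for i
        using nn_integral_mono[of M "h n J i" "\<lambda>_. 1"] h_le by (simp add: emeasure_space_1)
      then have c_le: "c \<le> 1"
        unfolding c_def by (intro prod_le_1) simp
      have split_j: "(\<Prod>i\<in>I. f i) = f j * (\<Prod>i\<in>I - {j}. f i)" for f :: "'i \<Rightarrow> ennreal"
        using I j by (simp add: prod.remove)
      \<comment> \<open>Weighting by the remaining factors changes the law of \<open>X j\<close>
        only by the constant \<open>c\<close>. Once the measures agree, integrating
        \<open>indicator (B j)\<close> puts the indicator in place of the power.\<close>
      have laws: "distr (density M R) borel (X j) = scale_measure c (distr M borel (X j))"
      proof (rule enexp_moments_unique)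
        have "emeasure (density M R) (space M) \<le> 1"
          using nn_integral_mono[of M "\<lambda>\<omega>. R \<omega>" "\<lambda>_. 1"] R_le
          by (simp add: emeasure_density emeasure_space_1 cong: nn_integral_cong)
        then show "finite_measure (distr (density M R) borel (X j))"
          by (intro finite_measure.finite_measure_distr finite_measureI) (auto simp: top_unique)
        show "finite_measure (scale_measure c (distr M borel (X j)))"
          using c_le emeasure_space_1
          by (intro finite_measureI) (auto simp: space_scale_measure emeasure_distr top_unique)
        fix m :: nat
        have "(\<integral>\<^sup>+z. enexp z ^ m \<partial>distr (density M R) borel (X j)) = (\<integral>\<^sup>+\<omega>. enexp (X j \<omega>) ^ m * R \<omega> \<partial>M)"
          by (simp add: nn_integral_distr nn_integral_density mult.commute)
        also have "\<dots> = (\<integral>\<^sup>+\<omega>. (\<Prod>i\<in>I. h (n(j := m)) J i \<omega>) \<partial>M)"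
          unfolding split_j R_def using j
          by (intro nn_integral_cong arg_cong2[where f = "(*)"] prod.cong) (auto simp: h_def)
        also have "\<dots> = (\<Prod>i\<in>I. \<integral>\<^sup>+\<omega>. h (n(j := m)) J i \<omega> \<partial>M)"
          by (rule insert.IH[OF J])
        also have "\<dots> = (\<integral>\<^sup>+\<omega>. enexp (X j \<omega>) ^ m \<partial>M) * c"
          unfolding split_j c_def using j
          by (intro arg_cong2[where f = "(*)"] prod.cong nn_integral_cong) (auto simp: h_def)
        also have "\<dots> = (\<integral>\<^sup>+z. enexp z ^ m \<partial>scale_measure c (distr M borel (X j)))"
          by (simp add: nn_integral_scale_measure nn_integral_distr mult.commute)
        finally show "(\<integral>\<^sup>+z. enexp z ^ m \<partial>distr (density M R) borel (X j)) = \<dots>" .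
      qed simp_all
      have "(\<integral>\<^sup>+\<omega>. (\<Prod>i\<in>I. h n (insert j J) i \<omega>) \<partial>M) = (\<integral>\<^sup>+\<omega>. indicator (B j) (X j \<omega>) * R \<omega> \<partial>M)"
        unfolding split_j R_def using j
        by (intro nn_integral_cong arg_cong2[where f = "(*)"] prod.cong) (auto simp: h_def)
      also have "\<dots> = (\<integral>\<^sup>+z. indicator (B j) z \<partial>distr (density M R) borel (X j))"
        by (subst nn_integral_distr) (simp_all add: nn_integral_density mult.commute)
      also have "\<dots> = c * (\<integral>\<^sup>+z. indicator (B j) z \<partial>distr M borel (X j))"
        unfolding laws by (rule nn_integral_scale_measure) simp
      also have "(\<integral>\<^sup>+z. indicator (B j) z \<partial>distr M borel (X j)) = (\<integral>\<^sup>+\<omega>. indicator (B j) (X j \<omega>) \<partial>M)"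
        by (subst nn_integral_distr) simp_all
      also have "c * \<dots> = (\<Prod>i\<in>I. \<integral>\<^sup>+\<omega>. h n (insert j J) i \<omega> \<partial>M)"
        unfolding split_j c_def mult.commute[of "prod _ _"] using j
        by (intro arg_cong2[where f = "(*)"] prod.cong nn_integral_cong) (auto simp: h_def)
      finally show ?case .
    qed
    from this[OF order_refl, of "\<lambda>_. 0"]
    have eq: "(\<integral>\<^sup>+\<omega>. (\<Prod>i\<in>I. indicator (B i) (X i \<omega>)) \<partial>M) = (\<Prod>i\<in>I. \<integral>\<^sup>+\<omega>. indicator (B i) (X i \<omega>) \<partial>M)"
      by (simp add: h_def)
    have "(\<integral>\<^sup>+\<omega>. indicator (B i) (X i \<omega>) \<partial>M) = emeasure M (X i -` B i \<inter> space M)" if "i \<in> I" for i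
    proof -
      have "(\<integral>\<^sup>+\<omega>. indicator (B i) (X i \<omega>) \<partial>M) = (\<integral>\<^sup>+\<omega>. indicator (X i -` B i \<inter> space M) \<omega> \<partial>M)"
        by (intro nn_integral_cong) (simp split: split_indicator)
      then show ?thesis using that by simp
    qed
    moreover have "(\<integral>\<^sup>+\<omega>. (\<Prod>i\<in>I. indicator (B i) (X i \<omega>)) \<partial>M) = emeasure M (\<Inter>i\<in>I. X i -` B i \<inter> space M)"
    proof -
      have "(\<Prod>i\<in>I. indicator (B i) (X i \<omega>)) = (indicator (\<Inter>i\<in>I. X i -` B i \<inter> space M) \<omega> :: ennreal)"
        if "\<omega> \<in> space M" for \<omega>
        using that I by (auto simp: indicator_def)
      then have "(\<integral>\<^sup>+\<omega>. (\<Prod>i\<in>I. indicator (B i) (X i \<omega>)) \<partial>M) =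
          (\<integral>\<^sup>+\<omega>. indicator (\<Inter>i\<in>I. X i -` B i \<inter> space M) \<omega> \<partial>M)"
        by (intro nn_integral_cong) simp
      also have "\<dots> = emeasure M (\<Inter>i\<in>I. X i -` B i \<inter> space M)"
        using I ne by (intro nn_integral_indicator sets.finite_INT) auto
      finally show ?thesis .
    qed
    ultimately have "ennreal (prob (\<Inter>i\<in>I. X i -` B i \<inter> space M)) = ennreal (\<Prod>i\<in>I. prob (X i -` B i \<inter> space M))"
      using eq by (simp add: emeasure_eq_measure prod_ennreal)
    then show ?thesis by (simp add: prod_nonneg)
  qed
  have "indep_sets (\<lambda>i. {X i -` A \<inter> space M |A. A \<in> sets borel}) I"
  proof (cases "I = {}")
    case True
    then show ?thesis by (simp add: indep_sets_def)
  next
    case False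
    show ?thesis
    proof (subst indep_sets_finite[OF False I])
      show "{X i -` A \<inter> space M |A. A \<in> sets borel} \<subseteq> events" if "i \<in> I" for i
        using X[OF that] by (auto intro: measurable_sets)
      show "space M \<in> {X i -` A \<inter> space M |A. A \<in> sets borel}" for i
        by (auto intro!: exI[of _ UNIV])
      show "\<forall>A\<in>(\<Pi> i\<in>I. {X i -` A \<inter> space M |A. A \<in> sets borel}). prob (\<Inter> (A ` I)) = (\<Prod>j\<in>I. prob (A j))"
      proof
        fix A assume "A \<in> (\<Pi> i\<in>I. {X i -` A \<inter> space M |A. A \<in> sets borel})"
        then have "\<forall>i\<in>I. \<exists>B. A i = X i -` B \<inter> space M \<and> B \<in> sets borel" by auto
        then obtain B where "\<And>i. i \<in> I \<Longrightarrow> A i = X i -` B i \<inter> space M" "\<And>i. i \<in> I \<Longrightarrow> B i \<in> sets borel"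
          by metis
        then show "prob (\<Inter> (A ` I)) = (\<Prod>j\<in>I. prob (A j))"
          using product[OF False, of B] by simp
      qed
    qed
  qed
  then show ?thesis
    using X by (simp add: indep_vars_def2)
qed

section \<open>Characterization and existence of Poisson processes\<close>

lemma one_minus_enexp_indicator:
  "1 - enexp (c * indicator A x) = (1 - enexp c) * indicator A x"
  by (simp split: split_indicator)

text \<open>At linear combinations of indicators the Laplace functional yields the joint moments of
  \<open>enexp\<close> of the counts, and these determine both the laws of the counts and their
  independence.\<close>

theorem poisson_processI:
  fixes \<nu> :: "'e measure"
  assumes P: "prob_space P"
    and points: "\<And>\<omega> j b. \<omega> \<in> space P \<Longrightarrow> Y \<omega> j = Some b \<Longrightarrow> b \<in> space \<nu>"
    and meas: "\<And>f. f \<in> borel_measurable \<nu> \<Longrightarrow> (\<lambda>\<omega>. point_sum f (Y \<omega>)) \<in> borel_measurable P"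
    and laplace: "\<And>f. f \<in> borel_measurable \<nu> \<Longrightarrow>
      (\<integral>\<^sup>+\<omega>. enexp (point_sum f (Y \<omega>)) \<partial>P) = enexp (\<integral>\<^sup>+x. 1 - enexp (f x) \<partial>\<nu>)"
  shows "poisson_process P Y \<nu>"
proof -
  interpret P: prob_space P by fact
  have N_meas [measurable]: "(\<lambda>\<omega>. num_points (Y \<omega>) A) \<in> borel_measurable P" if "A \<in> sets \<nu>" for A
    unfolding num_points_eq_point_sum using that by (intro meas) simp
  have moment: "(\<integral>\<^sup>+\<omega>. enexp (num_points (Y \<omega>) A) ^ n \<partial>P) = enexp ((1 - enexp (of_nat n)) * emeasure \<nu> A)"
    if [measurable]: "A \<in> sets \<nu>" for A and n :: nat
  proof -
    have "(\<integral>\<^sup>+\<omega>. enexp (num_points (Y \<omega>) A) ^ n \<partial>P) =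
        (\<integral>\<^sup>+\<omega>. enexp (point_sum (\<lambda>x. of_nat n * indicator A x) (Y \<omega>)) \<partial>P)"
      by (simp add: point_sum_cmult num_points_eq_point_sum enexp_of_nat_mult)
    also have "\<dots> = enexp (\<integral>\<^sup>+x. 1 - enexp (of_nat n * indicator A x) \<partial>\<nu>)"
      by (rule laplace) measurable
    also have "(\<integral>\<^sup>+x. 1 - enexp (of_nat n * indicator A x) \<partial>\<nu>) = (1 - enexp (of_nat n)) * emeasure \<nu> A"
      unfolding one_minus_enexp_indicator by (simp add: nn_integral_cmult)
    finally show ?thesis .
  qed
  have joint: "(\<integral>\<^sup>+\<omega>. (\<Prod>A\<in>\<A>. enexp (num_points (Y \<omega>) A) ^ n A) \<partial>P) =
      (\<Prod>A\<in>\<A>. \<integral>\<^sup>+\<omega>. enexp (num_points (Y \<omega>) A) ^ n A \<partial>P)"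
    if fin: "finite \<A>" and sub: "\<A> \<subseteq> sets \<nu>" and disj: "disjoint \<A>" for \<A> and n :: "'e set \<Rightarrow> nat"
  proof -
    have [measurable]: "A \<in> \<A> \<Longrightarrow> A \<in> sets \<nu>" for A using sub by auto
    have "(\<integral>\<^sup>+\<omega>. (\<Prod>A\<in>\<A>. enexp (num_points (Y \<omega>) A) ^ n A) \<partial>P) =
        (\<integral>\<^sup>+\<omega>. enexp (point_sum (\<lambda>x. \<Sum>A\<in>\<A>. of_nat (n A) * indicator A x) (Y \<omega>)) \<partial>P)"
      by (simp add: point_sum_sum point_sum_cmult num_points_eq_point_sum enexp_sum enexp_of_nat_mult)
    also have "\<dots> = enexp (\<integral>\<^sup>+x. 1 - enexp (\<Sum>A\<in>\<A>. of_nat (n A) * indicator A x) \<partial>\<nu>)"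
      by (rule laplace) measurable
    \<comment> \<open>At most one set of the disjoint family contains \<open>x\<close>, so both
      integrands reduce to a single term. This additivity of the exponent makes the joint moments
      factor.\<close>
    also have "(\<integral>\<^sup>+x. 1 - enexp (\<Sum>A\<in>\<A>. of_nat (n A) * indicator A x) \<partial>\<nu>) =
        (\<integral>\<^sup>+x. (\<Sum>A\<in>\<A>. (1 - enexp (of_nat (n A))) * indicator A x) \<partial>\<nu>)"
    proof (intro nn_integral_cong)
      fix x
      show "1 - enexp (\<Sum>A\<in>\<A>. of_nat (n A) * indicator A x) = (\<Sum>A\<in>\<A>. (1 - enexp (of_nat (n A))) * indicator A x)"
      proof (cases "\<exists>A\<in>\<A>. x \<in> A")
        case True
        then obtain A where A: "A \<in> \<A>" "x \<in> A" by auto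
        have "x \<notin> A'" if "A' \<in> \<A> - {A}" for A'
          using disjointD[OF disj A(1), of A'] that A by auto
        then have "(\<Sum>A'\<in>\<A> - {A}. c A' * indicator A' x) = 0" for c :: "'e set \<Rightarrow> ennreal"
          by (intro sum.neutral) simp
        then have "(\<Sum>A\<in>\<A>. c A * indicator A x) = c A" for c :: "'e set \<Rightarrow> ennreal"
          using A by (simp add: sum.remove[OF fin A(1)])
        then show ?thesis by simp
      next
        case False
        then have "indicator A x = (0 :: ennreal)" if "A \<in> \<A>" for A using that by auto
        then show ?thesis by simp
      qed
    qed
    also have "\<dots> = (\<Sum>A\<in>\<A>. (1 - enexp (of_nat (n A))) * emeasure \<nu> A)"
      by (subst nn_integral_sum) (auto simp: nn_integral_cmult)
    finally show ?thesis using sub by (simp add: enexp_sum moment subset_iff)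
  qed
  have poisson: "measure P {\<omega> \<in> space P. num_points (Y \<omega>) A = of_nat n} =
      measure \<nu> A ^ n / fact n * exp (- measure \<nu> A)"
    if A: "A \<in> sets \<nu>" "emeasure \<nu> A < \<infinity>" for A n
  proof -
    note [measurable] = A(1)
    let ?N = "\<lambda>\<omega>. num_points (Y \<omega>) A" and ?Q = "measure_pmf (pois (measure \<nu> A))"
    \<comment> \<open>Since \<open>enexp (of_nat k) ^ m\<close> is symmetric in \<open>k\<close> and
      \<open>m\<close>, the moment of order \<open>m\<close> on the Poisson side is a value of the
      generating function.\<close>
    have law: "distr P borel ?N = distr ?Q borel of_nat"
    proof (rule enexp_moments_unique)
      show "finite_measure (distr P borel ?N)"
        by (intro P.finite_measure_distr) measurable
      show "finite_measure (distr ?Q borel of_nat)"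
        by (intro measure_pmf.finite_measure_distr) measurable
      fix m :: nat
      have "enexp (of_nat k) ^ m = enexp (of_nat m) ^ k" for k
        by (simp flip: enexp_of_nat_mult add: mult.commute)
      then have "(\<integral>\<^sup>+z. enexp z ^ m \<partial>distr ?Q borel of_nat) = (\<integral>\<^sup>+k. enexp (of_nat m) ^ k \<partial>?Q)"
        by (subst nn_integral_distr) auto
      also have "\<dots> = enexp (ennreal (measure \<nu> A) * (1 - enexp (of_nat m)))"
        by (rule nn_integral_pois) simp_all
      also have "\<dots> = (\<integral>\<^sup>+\<omega>. enexp (?N \<omega>) ^ m \<partial>P)"
        using A by (simp add: moment emeasure_eq_ennreal_measure mult.commute)
      also have "\<dots> = (\<integral>\<^sup>+z. enexp z ^ m \<partial>distr P borel ?N)"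
        by (subst nn_integral_distr) simp_all
      finally show "(\<integral>\<^sup>+z. enexp z ^ m \<partial>distr P borel ?N) = (\<integral>\<^sup>+z. enexp z ^ m \<partial>distr ?Q borel of_nat)" ..
    qed simp_all
    have "measure P {\<omega> \<in> space P. ?N \<omega> = of_nat n} = measure (distr P borel ?N) {of_nat n}"
      by (subst measure_distr) (auto intro!: arg_cong2[where f = measure])
    also have "\<dots> = measure ?Q {n}"
      unfolding law by (subst measure_distr) (auto intro!: arg_cong2[where f = measure])
    finally show ?thesis by (simp add: measure_pmf_single pmf_pois)
  qed
  have infinite: "AE \<omega> in P. num_points (Y \<omega>) A = \<infinity>"
    if A [measurable]: "A \<in> sets \<nu>" and inf: "emeasure \<nu> A = \<infinity>" for A
  proof -
    \<comment> \<open>A positive factor times an infinite intensity is infinite, so the expectation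
      of \<open>enexp\<close> of the count is 0 and the count is almost surely infinite. Strictness
      here makes the factor positive.\<close>
    have "enexp (1 :: ennreal) < 1"
      using enexp_ennreal[of 1] by (simp add: ennreal_less_one_iff)
    then have "1 - enexp (1 :: ennreal) \<noteq> 0"
      by (simp add: diff_gr0_ennreal less_imp_neq[symmetric])
    then have "(\<integral>\<^sup>+\<omega>. enexp (num_points (Y \<omega>) A) \<partial>P) = 0"
      using moment[OF A, of 1] inf by (simp add: ennreal_mult_top)
    then show ?thesis
      by (subst (asm) nn_integral_0_iff_AE) auto
  qed
  have indep: "P.indep_vars (\<lambda>_. borel) (\<lambda>A \<omega>. num_points (Y \<omega>) A) \<A>"
    if "finite \<A>" "\<A> \<subseteq> sets \<nu>" "disjoint \<A>" for \<A>
    using that by (intro P.indep_vars_enexpI joint) auto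
  show ?thesis
    unfolding poisson_process_def using P points N_meas poisson infinite indep by blast
qed

text \<open>The process is the identity on families, since \<open>distributed_as_X\<close> asks for
  a probability space over that type; its law is the image of the cluster space. The Laplace
  functional is kept in the conclusion because sums of points are needed later, not only
  counts.\<close>

theorem poisson_process_exists:
  fixes \<nu> :: "'e measure"
  assumes "sigma_finite_measure \<nu>" and "space \<nu> \<noteq> {}"
  obtains P :: "(nat \<Rightarrow> 'e option) measure" where "poisson_process P (\<lambda>y. y) \<nu>"
    "\<And>f. f \<in> borel_measurable \<nu> \<Longrightarrow> point_sum f \<in> borel_measurable P"
    "\<And>f. f \<in> borel_measurable \<nu> \<Longrightarrow>
      (\<integral>\<^sup>+y. enexp (point_sum f y) \<partial>P) = enexp (\<integral>\<^sup>+x. 1 - enexp (f x) \<partial>\<nu>)"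
proof -
  obtain x0 where "x0 \<in> space \<nu>" using assms(2) by auto
  from sigma_finite_decomposition[OF assms(1) this]
  obtain r M where r: "\<And>k. 0 \<le> r k" and M: "\<And>k. prob_space (M k)" "\<And>k. sets (M k) = sets \<nu>"
    and decomp: "\<And>f. f \<in> borel_measurable \<nu> \<Longrightarrow>
      (\<integral>\<^sup>+x. f x \<partial>\<nu>) = (\<Sum>k. ennreal (r k) * (\<integral>\<^sup>+x. f x \<partial>M k))"
    by blast
  let ?W = "cluster_space r M"
  interpret W: prob_space ?W by (intro prob_space_cluster_space M)
  have space_M: "space (M k) = space \<nu>" for k by (rule sets_eq_imp_space_eq) (rule M)
  define S where "S = {y :: nat \<Rightarrow> 'e option. \<forall>j b. y j = Some b \<longrightarrow> b \<in> space \<nu>}"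
  \<comment> \<open>The largest sigma-algebra on \<open>S\<close> that makes
    \<open>cluster_points\<close> measurable. A function on families is then measurable as soon as
    its composition with \<open>cluster_points\<close> is.\<close>
  define \<S> where "\<S> = sigma S {A. A \<subseteq> S \<and> cluster_points -` A \<inter> space ?W \<in> sets ?W}"
  have space_\<S>: "space \<S> = S" by (simp add: \<S>_def space_measure_of_conv)
  have in_S: "cluster_points \<omega> \<in> S" if "\<omega> \<in> space ?W" for \<omega>
    using that by (auto simp: S_def cluster_points_def cluster_space_def space_PiM space_pair_measure
        PiE_iff space_M mem_Times_iff split: prod.splits if_splits)
  have cp [measurable]: "cluster_points \<in> measurable ?W \<S>"
    unfolding \<S>_def by (rule measurable_measure_of) (auto intro: in_S)
  have \<S>_measI: "g \<in> borel_measurable \<S>" if "(\<lambda>\<omega>. g (cluster_points \<omega>)) \<in> borel_measurable ?W"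
    for g :: "_ \<Rightarrow> ennreal"
  proof (rule measurableI)
    fix A :: "ennreal set" assume "A \<in> sets borel"
    then have "(\<lambda>\<omega>. g (cluster_points \<omega>)) -` A \<inter> space ?W \<in> sets ?W"
      using that by (rule measurable_sets[rotated])
    also have "(\<lambda>\<omega>. g (cluster_points \<omega>)) -` A \<inter> space ?W = cluster_points -` (g -` A \<inter> S) \<inter> space ?W"
      using in_S by auto
    finally show "g -` A \<inter> space \<S> \<in> sets \<S>"
      unfolding space_\<S> by (subst \<S>_def) (auto simp: sets_measure_of_conv)
  qed simp
  let ?P = "distr ?W \<S> cluster_points"
  have meas: "point_sum f \<in> borel_measurable \<S>" if "f \<in> borel_measurable \<nu>" for f
    using that M(2) by (intro \<S>_measI measurable_point_sum_cluster_points)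
  have laplace: "(\<integral>\<^sup>+y. enexp (point_sum f y) \<partial>?P) = enexp (\<integral>\<^sup>+x. 1 - enexp (f x) \<partial>\<nu>)"
    if f: "f \<in> borel_measurable \<nu>" for f
  proof -
    have [measurable]: "point_sum f \<in> borel_measurable \<S>" by (rule meas) (rule f)
    have "(\<integral>\<^sup>+y. enexp (point_sum f y) \<partial>?P) = (\<integral>\<^sup>+\<omega>. enexp (point_sum f (cluster_points \<omega>)) \<partial>?W)"
      by (subst nn_integral_distr) measurable
    also have "\<dots> = enexp (\<Sum>k. ennreal (r k) * (\<integral>\<^sup>+x. 1 - enexp (f x) \<partial>M k))"
      using r M f by (rule Laplace_functional_cluster_points)
    also have "(\<Sum>k. ennreal (r k) * (\<integral>\<^sup>+x. 1 - enexp (f x) \<partial>M k)) = (\<integral>\<^sup>+x. 1 - enexp (f x) \<partial>\<nu>)"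
      using f by (intro decomp[symmetric]) measurable
    finally show ?thesis .
  qed
  have "poisson_process ?P (\<lambda>y. y) \<nu>"
    using meas laplace by (intro poisson_processI W.prob_space_distr cp) (auto simp: space_\<S> S_def)
  then show thesis
    using meas laplace by (intro that) auto
qed

section \<open>Drift and Levy measure\<close>

definition Levy_measure :: "ennreal measure \<Rightarrow> bool" where
  "Levy_measure \<rho> \<longleftrightarrow> sets \<rho> = sets (restrict_space borel {0<..}) \<and>
     (\<forall>\<epsilon>::real. 0 < \<epsilon> \<longrightarrow> emeasure \<rho> {ennreal \<epsilon><..} < \<infinity>) \<and>
     (\<integral>\<^sup>+ s \<in> {0<..1}. s \<partial>\<rho>) < \<infinity>"

lemma measurable_restrict_pos:
  assumes "sets \<rho> = sets (restrict_space borel {0::ennreal<..})" and "f \<in> measurable borel N"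
  shows "f \<in> measurable \<rho> N"
  using measurable_restrict_space1[OF assms(2)] measurable_cong_sets[OF assms(1) refl] by blast

lemma one_minus_ennreal: "0 \<le> x \<Longrightarrow> 1 - ennreal x = ennreal (1 - x)"
  by (simp add: ennreal_minus[symmetric])

text \<open>For \<open>s \<le> 1\<close> this is \<open>1 - exp (- x) \<le> x\<close>, for larger
  \<open>s\<close> the trivial bound 1. The two terms match the two integrability conditions of a
  Levy measure.\<close>

lemma one_minus_enexp_bound:
  assumes "0 \<le> t"
  shows "1 - enexp (ennreal t * s) \<le> ennreal t * (s * indicator {0<..1} s) + indicator {1<..} s"
proof (cases "s \<le> 1")
  case True
  then obtain x where x: "s = ennreal x" "0 \<le> x" "x \<le> 1"
    by (cases s) (auto simp: top_unique)
  have "ennreal (1 - exp (- (t * x))) \<le> ennreal (t * x)"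
    using exp_ge_add_one_self[of "- (t * x)"] by (intro ennreal_leI) linarith
  then have "1 - enexp (ennreal t * s) \<le> ennreal t * s"
    using assms x by (simp add: enexp_ennreal ennreal_minus[symmetric] flip: ennreal_mult)
  then show ?thesis
    using True by (cases "s = 0") (simp_all add: indicator_def zero_less_iff_neq_zero leD)
next
  case False
  have "1 - enexp (ennreal t * s) \<le> 1" by (rule diff_le_self_ennreal)
  with False show ?thesis by simp
qed

lemma Levy_exponent_finite:
  assumes \<rho>: "Levy_measure \<rho>" and "0 \<le> t"
  shows "(\<integral>\<^sup>+s. 1 - enexp (ennreal t * s) \<partial>\<rho>) < \<top>"
proof -
  have sets: "sets \<rho> = sets (restrict_space borel {0<..})" using \<rho> by (simp add: Levy_measure_def)
  note meas = measurable_restrict_pos[OF sets]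
  have sub: "{1<..} \<in> sets \<rho>"
    unfolding sets sets_restrict_space by (auto intro!: image_eqI[of _ _ "{1<..}"] intro: order.strict_trans[of 0 1])
  have "(\<integral>\<^sup>+s. 1 - enexp (ennreal t * s) \<partial>\<rho>) \<le>
      (\<integral>\<^sup>+s. ennreal t * (s * indicator {0<..1} s) + indicator {1<..} s \<partial>\<rho>)"
    using \<open>0 \<le> t\<close> by (intro nn_integral_mono one_minus_enexp_bound)
  also have "\<dots> = ennreal t * (\<integral>\<^sup>+ s \<in> {0<..1}. s \<partial>\<rho>) + emeasure \<rho> {1<..}"
    using sub by (subst nn_integral_add) (auto intro!: meas nn_integral_cmult)
  also have "\<dots> < \<top>"
    using \<rho> by (auto simp: Levy_measure_def ennreal_mult_less_top dest!: spec[of _ "1::real"])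
  finally show ?thesis .
qed

text \<open>A Bochner integral is 0 when integrability fails, so the translation relies on
  \<open>Levy_exponent_finite\<close>. The integrand \<open>exp_neg t s - 1\<close> is nonpositive;
  its negative moves into the argument of \<open>enexp\<close>, where drift and jumps form one
  sum.\<close>

lemma has_drift_and_Levy_measure_iff:
  assumes L: "prob_space L" "sets L = sets borel"
  shows "has_drift_and_Levy_measure L \<gamma> \<rho> \<longleftrightarrow> 0 \<le> \<gamma> \<and> Levy_measure \<rho> \<and>
    (\<forall>t>0. (\<integral>\<^sup>+z. enexp (ennreal t * z) \<partial>L) =
       enexp (ennreal (\<gamma> * t) + (\<integral>\<^sup>+s. 1 - enexp (ennreal t * s) \<partial>\<rho>)))"
proof -
  have [measurable_cong]: "sets L = sets borel" by fact
  interpret L: prob_space L by fact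
  have lhs: "(\<integral>\<^sup>+z. enexp (ennreal t * z) \<partial>L) = ennreal (\<integral>z. exp_neg t z \<partial>L)" if "0 < t" for t
  proof -
    have "(\<integral>\<^sup>+z. enexp (ennreal t * z) \<partial>L) = (\<integral>\<^sup>+z. ennreal (exp_neg t z) \<partial>L)"
      using that by (simp add: exp_neg_eq_enexp ennreal_enn2real less_top[symmetric])
    also have "\<dots> = ennreal (\<integral>z. exp_neg t z \<partial>L)"
      using that by (intro nn_integral_eq_integral L.integrable_const_bound[where B = 1]) auto
    finally show ?thesis .
  qed
  have rhs: "enexp (ennreal (\<gamma> * t) + (\<integral>\<^sup>+s. 1 - enexp (ennreal t * s) \<partial>\<rho>)) =
      ennreal (exp (- \<gamma> * t) * exp (\<integral>s. (exp_neg t s - 1) \<partial>\<rho>))"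
    if "0 < t" "0 \<le> \<gamma>" and \<rho>: "Levy_measure \<rho>" for t
  proof -
    have sets: "sets \<rho> = sets (restrict_space borel {0<..})" using \<rho> by (simp add: Levy_measure_def)
    have eq: "1 - enexp (ennreal t * s) = ennreal (1 - exp_neg t s)" for s
      using that by (simp add: exp_neg_eq_enexp ennreal_enn2real less_top[symmetric] ennreal_minus[symmetric])
    have fin: "(\<integral>\<^sup>+s. ennreal (1 - exp_neg t s) \<partial>\<rho>) < \<top>"
      using Levy_exponent_finite[OF \<rho>, of t] that by (simp add: eq)
    have "(\<integral>s. (1 - exp_neg t s) \<partial>\<rho>) = enn2real (\<integral>\<^sup>+s. ennreal (1 - exp_neg t s) \<partial>\<rho>)"
      using that by (intro integral_eq_nn_integral measurable_restrict_pos[OF sets]) auto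
    then have "(\<integral>\<^sup>+s. 1 - enexp (ennreal t * s) \<partial>\<rho>) = ennreal (\<integral>s. (1 - exp_neg t s) \<partial>\<rho>)"
      using fin by (simp add: eq ennreal_enn2real)
    moreover have "(\<integral>s. (exp_neg t s - 1) \<partial>\<rho>) = - (\<integral>s. (1 - exp_neg t s) \<partial>\<rho>)"
      by (simp flip: Bochner_Integration.integral_minus)
    moreover have "0 \<le> (\<integral>s. (1 - exp_neg t s) \<partial>\<rho>)"
      using that by (intro integral_nonneg_AE) auto
    ultimately show ?thesis
      using that by (simp add: enexp_add enexp_ennreal flip: ennreal_mult)
  qed
  show ?thesis
  proof (cases "0 \<le> \<gamma> \<and> Levy_measure \<rho>")
    case True
    have "(\<integral>z. exp_neg t z \<partial>L) \<ge> 0" for t by (intro integral_nonneg_AE) simp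
    then have "(\<integral>z. exp_neg t z \<partial>L) = exp (- \<gamma> * t) * exp (\<integral>s. (exp_neg t s - 1) \<partial>\<rho>) \<longleftrightarrow>
      (\<integral>\<^sup>+z. enexp (ennreal t * z) \<partial>L) =
       enexp (ennreal (\<gamma> * t) + (\<integral>\<^sup>+s. 1 - enexp (ennreal t * s) \<partial>\<rho>))" if "0 < t" for t
      using that True by (simp only: lhs rhs) (subst ennreal_inj, auto)
    with True show ?thesis
      unfolding has_drift_and_Levy_measure_def Levy_measure_def by auto
  next
    case False
    then show ?thesis
      unfolding has_drift_and_Levy_measure_def Levy_measure_def by auto
  qed
qed

lemma Levy_measure_sigma_finite:
  assumes \<rho>: "Levy_measure \<rho>"
  shows "sigma_finite_measure \<rho>"
proof
  have sets: "sets \<rho> = sets (restrict_space borel {0<..})" using \<rho> by (simp add: Levy_measure_def)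
  have space: "space \<rho> = {0<..}" using sets_eq_imp_space_eq[OF sets] by (simp add: space_restrict_space)
  let ?A = "\<lambda>n::nat. {ennreal (1 / Suc n)<..}"
  have "?A n \<in> sets \<rho>" for n
    unfolding sets sets_restrict_space
    by (auto intro!: image_eqI[of _ _ "?A n"] intro: le_less_trans[OF zero_le])
  moreover have "\<exists>n. x \<in> ?A n" if "0 < x" for x
  proof (cases x)
    case (real r)
    then have "0 < r" using that by simp
    then obtain n where "inverse (real (Suc n)) < r" using reals_Archimedean by blast
    then show ?thesis using real by (auto simp: ennreal_less_iff inverse_eq_divide intro!: exI[of _ n])
  qed auto
  ultimately show "\<exists>A. countable A \<and> A \<subseteq> sets \<rho> \<and> \<Union> A = space \<rho> \<and> (\<forall>a\<in>A. emeasure \<rho> a \<noteq> \<infinity>)"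
    using \<rho> space by (intro exI[of _ "range ?A"])
      (auto simp: Levy_measure_def less_top[symmetric] intro: le_less_trans[OF zero_le])
qed

section \<open>Existence of laws with given drift and Levy measure\<close>

theorem infinitely_divisible_law_exists:
  assumes \<rho>: "Levy_measure \<rho>" and "0 \<le> \<gamma>"
  obtains L where "prob_space L" "sets L = sets borel"
    "\<And>t. 0 \<le> t \<Longrightarrow> (\<integral>\<^sup>+z. enexp (ennreal t * z) \<partial>L) =
       enexp (ennreal (\<gamma> * t) + (\<integral>\<^sup>+s. 1 - enexp (ennreal t * s) \<partial>\<rho>))"
proof -
  have sets: "sets \<rho> = sets (restrict_space borel {0<..})" using \<rho> by (simp add: Levy_measure_def)
  have space: "space \<rho> = {0<..}" using sets_eq_imp_space_eq[OF sets] by (simp add: space_restrict_space)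
  note meas = measurable_restrict_pos[OF sets]
  have "1 \<in> space \<rho>" by (simp add: space)
  then have "space \<rho> \<noteq> {}" by blast
  from poisson_process_exists[OF Levy_measure_sigma_finite[OF \<rho>] this]
  obtain P where P: "poisson_process P (\<lambda>y. y) \<rho>"
    and ps: "\<And>f. f \<in> borel_measurable \<rho> \<Longrightarrow> point_sum f \<in> borel_measurable P"
    and laplace: "\<And>f. f \<in> borel_measurable \<rho> \<Longrightarrow>
      (\<integral>\<^sup>+y. enexp (point_sum f y) \<partial>P) = enexp (\<integral>\<^sup>+x. 1 - enexp (f x) \<partial>\<rho>)"
    by blast
  interpret P: prob_space P using P by (simp add: poisson_process_def)
  have [measurable]: "point_sum (\<lambda>s. s) \<in> borel_measurable P"
    by (intro ps meas) simp
  show thesis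
  proof (rule that)
    \<comment> \<open>Drift plus the sum of the points of a Poisson process with intensity
      \<open>\<rho>\<close>; scaling the points by \<open>t\<close> turns the Laplace functional
      into the required formula. A point at infinity makes the sum infinite.\<close>
    let ?L = "distr P borel (\<lambda>y. ennreal \<gamma> + point_sum (\<lambda>s. s) y)"
    show "prob_space ?L" by (rule P.prob_space_distr) measurable
    show "sets ?L = sets borel" by simp
    \<comment> \<open>The value \<open>t = 0\<close> is included, where both sides are 1; it
      supplies the moment of order 0 when laws are compared.\<close>
    fix t :: real assume "0 \<le> t"
    have "(\<integral>\<^sup>+z. enexp (ennreal t * z) \<partial>?L) =
        (\<integral>\<^sup>+y. enexp (ennreal (\<gamma> * t)) * enexp (point_sum (\<lambda>s. ennreal t * s) y) \<partial>P)"
      using \<open>0 \<le> t\<close> \<open>0 \<le> \<gamma>\<close>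
      by (subst nn_integral_distr)
        (auto simp: distrib_left enexp_add point_sum_cmult mult.commute ennreal_mult)
    also have "\<dots> = enexp (ennreal (\<gamma> * t)) * (\<integral>\<^sup>+y. enexp (point_sum (\<lambda>s. ennreal t * s) y) \<partial>P)"
      by (rule nn_integral_cmult) (simp add: point_sum_cmult)
    also have "(\<integral>\<^sup>+y. enexp (point_sum (\<lambda>s. ennreal t * s) y) \<partial>P) = enexp (\<integral>\<^sup>+s. 1 - enexp (ennreal t * s) \<partial>\<rho>)"
      by (intro laplace meas) simp
    finally show "(\<integral>\<^sup>+z. enexp (ennreal t * z) \<partial>?L) =
       enexp (ennreal (\<gamma> * t) + (\<integral>\<^sup>+s. 1 - enexp (ennreal t * s) \<partial>\<rho>))"
      by (simp add: enexp_add)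
  qed
qed

section \<open>Uniqueness of drift and Levy measure\<close>

text \<open>
  Taking second differences of the exponent \<open>\<psi>(n) = \<gamma> n + \<integral> (1 - e\<^sup>-\<^sup>n\<^sup>s) d\<rho>(s)\<close> removes the drift
  and leaves the moments \<open>\<integral> e\<^sup>-\<^sup>n\<^sup>s (1 - e\<^sup>-\<^sup>s)\<^sup>2 d\<rho>(s)\<close> of a finite measure equivalent to \<open>\<rho>\<close>.
\<close>

lemma Levy_exponent_unique:
  assumes \<rho>: "Levy_measure \<rho>1" "Levy_measure \<rho>2" and \<gamma>: "0 \<le> \<gamma>1" "0 \<le> \<gamma>2"
    and eq: "\<And>n::nat. 0 < n \<Longrightarrow> ennreal (\<gamma>1 * n) + (\<integral>\<^sup>+s. 1 - enexp (ennreal n * s) \<partial>\<rho>1) =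
      ennreal (\<gamma>2 * n) + (\<integral>\<^sup>+s. 1 - enexp (ennreal n * s) \<partial>\<rho>2)"
  shows "\<gamma>1 = \<gamma>2 \<and> \<rho>1 = \<rho>2"
proof -
  define \<psi> where "\<psi> \<gamma> \<rho> n = ennreal (\<gamma> * real n) + (\<integral>\<^sup>+s. 1 - enexp (ennreal (real n) * s) \<partial>\<rho>)"
    for \<gamma> \<rho> and n :: nat
  define a where "a \<rho> n = (\<integral>\<^sup>+s. enexp s ^ n * (1 - enexp s) \<partial>\<rho>)" for \<rho> and n :: nat
  define b where "b \<rho> n = (\<integral>\<^sup>+s. enexp s ^ n * (1 - enexp s)\<^sup>2 \<partial>\<rho>)" for \<rho> and n :: nat
  have en: "enexp (ennreal (real n) * s) = enexp s ^ n" for n s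
    by (simp add: ennreal_of_nat_eq_real_of_nat[symmetric] enexp_of_nat_mult)
  have \<psi>_eq: "\<psi> \<gamma>1 \<rho>1 n = \<psi> \<gamma>2 \<rho>2 n" for n
    using eq[of n] by (cases "n = 0") (simp_all add: \<psi>_def)
  have \<psi>_fin: "\<psi> \<gamma> \<rho> n < \<top>" if "Levy_measure \<rho>" for \<gamma> \<rho> n
    using Levy_exponent_finite[OF that, of "real n"] by (simp add: \<psi>_def)
  have a_fin: "a \<rho> n < \<top>" if "Levy_measure \<rho>" for \<rho> n
  proof -
    have "a \<rho> n \<le> (\<integral>\<^sup>+s. 1 - enexp (ennreal 1 * s) \<partial>\<rho>)"
      unfolding a_def by (intro nn_integral_mono) (simp add: mult_right_le_one_le power_le_one mult_left_le mult.commute[of "enexp _ ^ _"])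
    then show ?thesis using Levy_exponent_finite[OF that, of 1] by (simp add: le_less_trans)
  qed
  have u_split: "1 - u ^ Suc n = (1 - u ^ n) + u ^ n * (1 - u)"
    "u ^ n * (1 - u) = u ^ Suc n * (1 - u) + u ^ n * (1 - u)\<^sup>2" if u_le: "u \<le> 1" for u :: ennreal and n
  proof -
    obtain v where v: "u = ennreal v" "0 \<le> v" "v \<le> 1"
      using u_le by (cases u) (auto simp: top_unique)
    show "1 - u ^ Suc n = (1 - u ^ n) + u ^ n * (1 - u)"
      using v by (simp add: ennreal_power one_minus_ennreal power_le_one mult_le_one algebra_simps mult_left_le_one_le
          flip: ennreal_plus ennreal_mult)
    show "u ^ n * (1 - u) = u ^ Suc n * (1 - u) + u ^ n * (1 - u)\<^sup>2"
    proof -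
      have "u ^ m * (1 - u) ^ k = ennreal (v ^ m * (1 - v) ^ k)" for m k
        using v by (simp add: ennreal_power one_minus_ennreal ennreal_mult)
      from this[of _ 1] this[of _ 2]
      have "u ^ m * (1 - u) = ennreal (v ^ m * (1 - v))" "u ^ m * (1 - u)\<^sup>2 = ennreal (v ^ m * (1 - v)\<^sup>2)" for m
        by simp_all
      moreover have "v ^ n * (1 - v) = v ^ Suc n * (1 - v) + v ^ n * (1 - v)\<^sup>2"
        by (simp add: algebra_simps power2_eq_square)
      ultimately show ?thesis using v by (simp del: power_Suc flip: ennreal_plus)
    qed
  qed
  have \<psi>_Suc: "\<psi> \<gamma> \<rho> (Suc n) = \<psi> \<gamma> \<rho> n + (ennreal \<gamma> + a \<rho> n)"
    if \<rho>: "Levy_measure \<rho>" and "0 \<le> \<gamma>" for \<gamma> \<rho> n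
  proof -
    note meas = measurable_restrict_pos[of \<rho>]
    have sets: "sets \<rho> = sets (restrict_space borel {0<..})" using \<rho> by (simp add: Levy_measure_def)
    have "(\<integral>\<^sup>+s. 1 - enexp s ^ Suc n \<partial>\<rho>) = (\<integral>\<^sup>+s. (1 - enexp s ^ n) + enexp s ^ n * (1 - enexp s) \<partial>\<rho>)"
      by (intro nn_integral_cong u_split) simp
    also have "\<dots> = (\<integral>\<^sup>+s. 1 - enexp s ^ n \<partial>\<rho>) + a \<rho> n"
      unfolding a_def by (intro nn_integral_add meas sets) measurable
    finally have "(\<integral>\<^sup>+s. 1 - enexp s ^ Suc n \<partial>\<rho>) = (\<integral>\<^sup>+s. 1 - enexp s ^ n \<partial>\<rho>) + a \<rho> n" .
    moreover have "ennreal (\<gamma> * real (Suc n)) = ennreal (\<gamma> * real n) + ennreal \<gamma>"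
      using \<open>0 \<le> \<gamma>\<close> by (simp add: algebra_simps flip: ennreal_plus)
    ultimately show ?thesis
      unfolding \<psi>_def en by (simp only: ac_simps)
  qed
  have a_split: "a \<rho> n = a \<rho> (Suc n) + b \<rho> n" if \<rho>: "Levy_measure \<rho>" for \<rho> n
  proof -
    note meas = measurable_restrict_pos[of \<rho>]
    have sets: "sets \<rho> = sets (restrict_space borel {0<..})" using \<rho> by (simp add: Levy_measure_def)
    have "a \<rho> n = (\<integral>\<^sup>+s. enexp s ^ Suc n * (1 - enexp s) + enexp s ^ n * (1 - enexp s)\<^sup>2 \<partial>\<rho>)"
      unfolding a_def by (intro nn_integral_cong u_split) simp
    also have "\<dots> = a \<rho> (Suc n) + b \<rho> n"
      unfolding a_def b_def by (intro nn_integral_add meas sets) measurable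
    finally show ?thesis .
  qed
  \<comment> \<open>Cancelling \<open>\<psi>\<close> is legitimate because it is finite. The first
    difference still contains the drift, as a term constant in \<open>n\<close>.\<close>
  have \<gamma>a: "ennreal \<gamma>1 + a \<rho>1 n = ennreal \<gamma>2 + a \<rho>2 n" for n
    using \<psi>_eq[of "Suc n"] \<psi>_eq[of n] \<psi>_fin[OF \<rho>(2), of \<gamma>2 n] \<gamma> \<rho>
    by (auto simp: \<psi>_Suc ennreal_add_left_cancel)
  \<comment> \<open>A second difference removes that constant: \<open>b\<close> is the decrease of
    \<open>a\<close> from \<open>n\<close> to \<open>Suc n\<close>, and \<open>a\<close> is
    finite.\<close>
  have b_eq: "b \<rho>1 n = b \<rho>2 n" for n
  proof -
    have "ennreal \<gamma>1 + a \<rho>1 (Suc n) + b \<rho>1 n = ennreal \<gamma>2 + a \<rho>2 (Suc n) + b \<rho>2 n"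
      using \<gamma>a[of n] a_split[OF \<rho>(1), of n] a_split[OF \<rho>(2), of n] by (simp add: add.assoc)
    then show ?thesis
      using \<gamma>a[of "Suc n"] a_fin[OF \<rho>(2), of "Suc n"] by (auto simp: ennreal_add_left_cancel)
  qed
  \<comment> \<open>The weight makes \<open>\<rho>\<close> finite, and \<open>b \<rho> n\<close> is
    the moment of order \<open>n\<close> of \<open>enexp\<close> under the weighted measure. As
    \<open>w\<close> vanishes only at 0, outside the space of \<open>\<rho>\<close>, dividing by it
    recovers \<open>\<rho>\<close>.\<close>
  define w :: "ennreal \<Rightarrow> ennreal" where "w s = (1 - enexp s)\<^sup>2" for s
  have [measurable]: "w \<in> borel_measurable borel" unfolding w_def[abs_def] by measurable
  \<comment> \<open>The identity map only enlarges the underlying space from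
    \<open>(0,\<infinity>]\<close> to all of \<open>ennreal\<close>, where
    \<open>enexp_moments_unique\<close> applies.\<close>
  define D where "D \<rho> = distr (density \<rho> w) borel (\<lambda>s. s)" for \<rho>
  have w_inv: "w s * inverse (w s) = 1" if "0 < s" for s
  proof (cases s)
    case (real r)
    then have "r > 0" using that by simp
    then have "w s = ennreal ((1 - exp (- r))\<^sup>2)" "(1 - exp (- r))\<^sup>2 > 0"
      using real by (simp_all add: w_def enexp_ennreal one_minus_ennreal ennreal_power)
    then show ?thesis by (simp add: inverse_ennreal flip: ennreal_mult)
  qed (simp add: w_def)
  have D: "(\<integral>\<^sup>+s. f s \<partial>D \<rho>) = (\<integral>\<^sup>+s. w s * f s \<partial>\<rho>)"
    if \<rho>: "Levy_measure \<rho>" and f [measurable]: "f \<in> borel_measurable borel" for \<rho> f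
  proof -
    have sets: "sets \<rho> = sets (restrict_space borel {0<..})" using \<rho> by (simp add: Levy_measure_def)
    note meas = measurable_restrict_pos[OF sets]
    have "(\<lambda>s. s) \<in> measurable (density \<rho> w) borel"
      by (simp add: measurable_density_eq1 meas)
    then show ?thesis
      unfolding D_def by (subst nn_integral_distr) (auto intro!: nn_integral_density meas)
  qed
  have D_fin: "finite_measure (D \<rho>)" if "Levy_measure \<rho>" for \<rho>
  proof (rule finite_measureI)
    have "emeasure (D \<rho>) (space (D \<rho>)) = (\<integral>\<^sup>+s. 1 \<partial>D \<rho>)" by simp
    also have "\<dots> = b \<rho> 0" by (subst D[OF that]) (simp_all add: b_def w_def)
    also have "\<dots> \<le> a \<rho> 0" using a_split[OF that, of 0] by simp
    finally show "emeasure (D \<rho>) (space (D \<rho>)) \<noteq> \<infinity>"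
      using a_fin[OF that, of 0] by (auto simp: top_unique)
  qed
  have D_eq: "D \<rho>1 = D \<rho>2"
  proof (rule enexp_moments_unique)
    show "(\<integral>\<^sup>+z. enexp z ^ n \<partial>D \<rho>1) = (\<integral>\<^sup>+z. enexp z ^ n \<partial>D \<rho>2)" for n
      using b_eq[of n] \<rho> by (simp add: D b_def w_def mult.commute)
  qed (use \<rho> D_fin in \<open>auto simp: D_def\<close>)
  have "\<rho>1 = \<rho>2"
  proof (rule measure_eqI)
    show "sets \<rho>1 = sets \<rho>2" using \<rho> by (simp add: Levy_measure_def)
    fix A assume "A \<in> sets \<rho>1"
    then have "A \<in> sets (restrict_space borel {0<..})" using \<rho> by (simp add: Levy_measure_def)
    then have A: "A \<in> sets borel" "A \<subseteq> {0<..}"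
      by (auto simp: sets_restrict_space)
    note [measurable] = A(1)
    have "emeasure \<rho> A = (\<integral>\<^sup>+s. indicator A s * inverse (w s) \<partial>D \<rho>)" if "Levy_measure \<rho>" for \<rho>
    proof -
      have "A \<in> sets \<rho>" using \<open>A \<in> sets \<rho>1\<close> that \<rho> by (simp add: Levy_measure_def)
      then have "emeasure \<rho> A = (\<integral>\<^sup>+s. indicator A s \<partial>\<rho>)" by simp
      also have "\<dots> = (\<integral>\<^sup>+s. w s * (indicator A s * inverse (w s)) \<partial>\<rho>)"
        using A(2) w_inv by (intro nn_integral_cong) (auto split: split_indicator)
      also have "\<dots> = (\<integral>\<^sup>+s. indicator A s * inverse (w s) \<partial>D \<rho>)"
        by (rule D[OF that, symmetric]) measurable
      finally show ?thesis .
    qed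
    then show "emeasure \<rho>1 A = emeasure \<rho>2 A" using \<rho> D_eq by simp
  qed
  \<comment> \<open>With equal Levy measures, the first difference at 0 leaves the equality of the
    drifts.\<close>
  then show ?thesis
    using \<gamma>a[of 0] a_fin[OF \<rho>(2), of 0] \<gamma> by (auto simp: ennreal_add_left_cancel add.commute[of "ennreal _"])
qed

section \<open>Infinite divisibility\<close>

lemma enexp_real_mult: "enexp (ennreal (real n) * z) = enexp z ^ n"
  by (simp add: enexp_of_nat_mult flip: ennreal_of_nat_eq_real_of_nat)

lemma ennreal_mult_real: "0 \<le> \<gamma> \<Longrightarrow> ennreal (\<gamma> * real n) = of_nat n * ennreal \<gamma>"
  by (simp add: ennreal_mult mult.commute flip: ennreal_of_nat_eq_real_of_nat)

lemma Levy_measure_scale: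
  assumes \<rho>: "Levy_measure \<rho>" and r: "r < \<top>"
  shows "Levy_measure (scale_measure r \<rho>)"
proof -
  have sets: "sets \<rho> = sets (restrict_space borel {0<..})" using \<rho> by (simp add: Levy_measure_def)
  have "(\<integral>\<^sup>+ s \<in> {0<..1}. s \<partial>scale_measure r \<rho>) = r * (\<integral>\<^sup>+ s \<in> {0<..1}. s \<partial>\<rho>)"
    by (intro nn_integral_scale_measure measurable_restrict_pos[OF sets]) measurable
  then show ?thesis
    using \<rho> r by (simp add: Levy_measure_def ennreal_mult_less_top)
qed

lemma Levy_measure_density_indicator:
  assumes \<rho>: "Levy_measure \<rho>" and A: "A \<in> sets borel"
  shows "Levy_measure (density \<rho> (indicator A))"
proof -
  have sets: "sets \<rho> = sets (restrict_space borel {0<..})" using \<rho> by (simp add: Levy_measure_def)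
  note meas = measurable_restrict_pos[OF sets]
  note [measurable] = A
  have ind: "indicator A \<in> borel_measurable \<rho>" by (intro meas) measurable
  have int: "(\<integral>\<^sup>+s. f s \<partial>density \<rho> (indicator A)) \<le> (\<integral>\<^sup>+s. f s \<partial>\<rho>)" if "f \<in> borel_measurable \<rho>" for f
    using that ind by (subst nn_integral_density) (auto intro!: nn_integral_mono split: split_indicator)
  have "emeasure (density \<rho> (indicator A)) {ennreal \<epsilon><..} < \<infinity>" if "0 < \<epsilon>" for \<epsilon>
  proof -
    have "{ennreal \<epsilon><..} \<in> sets \<rho>"
      unfolding sets sets_restrict_space
      by (auto intro!: image_eqI[of _ _ "{ennreal \<epsilon><..}"] intro: le_less_trans[OF zero_le])
    then have "emeasure (density \<rho> (indicator A)) {ennreal \<epsilon><..} \<le> emeasure \<rho> {ennreal \<epsilon><..}"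
      using int[of "indicator {ennreal \<epsilon><..}"] by simp
    also have "\<dots> < \<infinity>" using \<rho> that by (simp add: Levy_measure_def)
    finally show ?thesis .
  qed
  moreover have "(\<integral>\<^sup>+ s \<in> {0<..1}. s \<partial>density \<rho> (indicator A)) < \<infinity>"
    using \<rho> by (intro le_less_trans[OF int] meas) (simp_all add: Levy_measure_def)
  ultimately show ?thesis by (simp add: Levy_measure_def sets)
qed

lemma tendsto_enexp_inverse_mult:
  assumes "z < \<top>"
  shows "(\<lambda>n. enexp (ennreal (inverse (Suc n)) * z)) \<longlonglongrightarrow> 1"
proof -
  obtain x where x: "z = ennreal x" "0 \<le> x" using assms by (cases z) auto
  have "(\<lambda>n. ennreal (inverse (Suc n) * x)) \<longlonglongrightarrow> ennreal (0 * x)"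
    by (intro tendsto_intros LIMSEQ_inverse_real_of_nat)
  from tendsto_enexp[OF this] show ?thesis using x by (simp add: ennreal_mult)
qed

text \<open>The probability of a finite value is the limit of the Laplace transform as
  \<open>t\<close> decreases to 0. Along \<open>t = 1 / (n + 1)\<close> the exponent tends to 0 by
  dominated convergence, with the integrand at \<open>t = 1\<close> as the bound.\<close>

lemma infinitely_divisible_law_finite:
  assumes \<rho>: "Levy_measure \<rho>" "emeasure \<rho> {\<top>} = 0" and "0 \<le> \<gamma>"
    and L: "prob_space L" "sets L = sets borel"
    and laplace: "\<And>t. 0 \<le> t \<Longrightarrow> (\<integral>\<^sup>+z. enexp (ennreal t * z) \<partial>L) =
       enexp (ennreal (\<gamma> * t) + (\<integral>\<^sup>+s. 1 - enexp (ennreal t * s) \<partial>\<rho>))"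
  shows "AE z in L. z < \<top>"
proof -
  interpret L: prob_space L by fact
  have [measurable_cong]: "sets L = sets borel" by fact
  have sets: "sets \<rho> = sets (restrict_space borel {0<..})" using \<rho> by (simp add: Levy_measure_def)
  note meas = measurable_restrict_pos[OF sets]
  let ?t = "\<lambda>n::nat. inverse (real (Suc n))"
  have top: "{\<top>} \<in> sets \<rho>"
    unfolding sets sets_restrict_space by (auto intro!: image_eqI[of _ _ "{\<top>}"])
  have "(\<lambda>n. \<integral>\<^sup>+z. enexp (ennreal (?t n) * z) \<partial>L) \<longlonglongrightarrow> (\<integral>\<^sup>+z. indicator {..<\<top>} z \<partial>L)"
  proof (rule nn_integral_dominated_convergence[where w = "\<lambda>_. 1"])
    show "AE z in L. (\<lambda>n. enexp (ennreal (?t n) * z)) \<longlonglongrightarrow> indicator {..<\<top>} z"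
    proof (rule AE_I2)
      fix z show "(\<lambda>n. enexp (ennreal (?t n) * z)) \<longlonglongrightarrow> indicator {..<\<top>} z"
        by (cases "z = \<top>") (simp_all add: ennreal_mult_top less_top[symmetric] tendsto_enexp_inverse_mult
            del: of_nat_Suc)
    qed
  qed (auto simp: L.emeasure_space_1)
  moreover have "(\<lambda>n. enexp (ennreal (\<gamma> * ?t n) + (\<integral>\<^sup>+s. 1 - enexp (ennreal (?t n) * s) \<partial>\<rho>))) \<longlonglongrightarrow>
      enexp (ennreal (\<gamma> * 0) + (\<integral>\<^sup>+s. 0 \<partial>\<rho>))"
  proof (intro tendsto_enexp tendsto_add tendsto_intros LIMSEQ_inverse_real_of_nat)
    show "(\<lambda>n. \<integral>\<^sup>+s. 1 - enexp (ennreal (?t n) * s) \<partial>\<rho>) \<longlonglongrightarrow> (\<integral>\<^sup>+s. 0 \<partial>\<rho>)"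
    proof (rule nn_integral_dominated_convergence[where w = "\<lambda>s. 1 - enexp (ennreal 1 * s)"])
      show "(\<integral>\<^sup>+s. 1 - enexp (ennreal 1 * s) \<partial>\<rho>) < \<infinity>"
        using Levy_exponent_finite[OF \<rho>(1), of 1] by simp
      have "ennreal (?t n) \<le> ennreal 1" for n
        by (intro ennreal_leI) (simp add: inverse_eq_divide)
      then show "AE s in \<rho>. 1 - enexp (ennreal (?t n) * s) \<le> 1 - enexp (ennreal 1 * s)" for n
        by (intro AE_I2 ennreal_minus_mono enexp_antimono mult_right_mono) auto
      \<comment> \<open>At \<open>s = \<infinity>\<close> the integrand equals 1 for every
        \<open>n\<close>; the limit is 0 almost everywhere because \<open>\<rho>\<close> does not
        charge this point.\<close>
      have "AE s in \<rho>. s \<notin> {\<top>}"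
        using \<rho>(2) top by (intro AE_not_in) (simp add: null_sets_def)
      then show "AE s in \<rho>. (\<lambda>n. 1 - enexp (ennreal (?t n) * s)) \<longlonglongrightarrow> 0"
      proof eventually_elim
        case (elim s)
        then have "(\<lambda>n. 1 - enexp (ennreal (?t n) * s)) \<longlonglongrightarrow> 1 - 1"
          by (intro tendsto_diff_ennreal tendsto_const tendsto_enexp_inverse_mult)
            (auto simp: less_top[symmetric])
        then show ?case by simp
      qed
    qed (intro meas; measurable)+
  qed
  ultimately have "(\<integral>\<^sup>+z. indicator {..<\<top>} z \<partial>L) = 1"
    by (simp add: laplace LIMSEQ_unique)
  then have "emeasure L {..<\<top>} = 1" by simp
  then have "AE z in L. z \<in> {..<\<top>}"
    by (intro L.AE_in_set_eq_1[THEN iffD2]) (simp_all add: L.emeasure_eq_measure)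
  then show ?thesis by simp
qed

text \<open>Almost sure finiteness lets \<open>enn2real\<close> carry the constructed law to the
  real line without changing its transform.\<close>

lemma infinitely_divisible_real_law_exists:
  assumes \<rho>: "Levy_measure \<rho>" "emeasure \<rho> {\<top>} = 0" and "0 \<le> \<gamma>"
  obtains K where "real_distribution K" "AE x in K. 0 \<le> x"
    "\<And>n::nat. (\<integral>\<^sup>+x. enexp (ennreal x) ^ n \<partial>K) =
       enexp (of_nat n * (ennreal \<gamma>) + (\<integral>\<^sup>+s. 1 - enexp s ^ n \<partial>\<rho>))"
proof -
  obtain L where L: "prob_space L" "sets L = sets borel"
    and laplace: "\<And>t. 0 \<le> t \<Longrightarrow> (\<integral>\<^sup>+z. enexp (ennreal t * z) \<partial>L) =
       enexp (ennreal (\<gamma> * t) + (\<integral>\<^sup>+s. 1 - enexp (ennreal t * s) \<partial>\<rho>))"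
    using infinitely_divisible_law_exists[OF \<rho>(1) \<open>0 \<le> \<gamma>\<close>] by blast
  have fin: "AE z in L. z < \<top>"
    by (rule infinitely_divisible_law_finite[OF \<rho> \<open>0 \<le> \<gamma>\<close> L laplace])
  interpret L: prob_space L by fact
  have [measurable_cong]: "sets L = sets borel" by fact
  show thesis
  proof (rule that)
    let ?K = "distr L borel enn2real"
    show "real_distribution ?K" by (rule L.real_distribution_distr) measurable
    show "AE x in ?K. 0 \<le> x" by (subst AE_distr_iff) auto
    fix n :: nat
    have "(\<integral>\<^sup>+x. enexp (ennreal x) ^ n \<partial>?K) = (\<integral>\<^sup>+z. enexp (ennreal (enn2real z)) ^ n \<partial>L)"
      by (subst nn_integral_distr) measurable
    also have "\<dots> = (\<integral>\<^sup>+z. enexp (ennreal (real n) * z) \<partial>L)"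
      using fin by (intro nn_integral_cong_AE)
        (auto elim!: eventually_mono simp: ennreal_enn2real enexp_real_mult)
    also have "\<dots> = enexp (ennreal (\<gamma> * real n) + (\<integral>\<^sup>+s. 1 - enexp (ennreal (real n) * s) \<partial>\<rho>))"
      by (rule laplace) simp
    also have "\<dots> = enexp (of_nat n * (ennreal \<gamma>) + (\<integral>\<^sup>+s. 1 - enexp s ^ n \<partial>\<rho>))"
      using \<open>0 \<le> \<gamma>\<close> by (simp add: enexp_real_mult ennreal_mult_real)
    finally show "(\<integral>\<^sup>+x. enexp (ennreal x) ^ n \<partial>?K) = \<dots>" .
  qed
qed

text \<open>\<open>ennreal\<close> collapses the negative numbers to 0, so \<open>enn2real\<close>
  undoes it only on nonnegative values; this is where the sign hypotheses enter.\<close>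

lemma nonneg_law_unique:
  assumes "real_distribution K1" "real_distribution K2"
    and nonneg: "AE x in K1. 0 \<le> x" "AE x in K2. 0 \<le> x"
    and moments: "\<And>n::nat. (\<integral>\<^sup>+x. enexp (ennreal x) ^ n \<partial>K1) = (\<integral>\<^sup>+x. enexp (ennreal x) ^ n \<partial>K2)"
  shows "K1 = K2"
proof -
  interpret K1: real_distribution K1 by fact
  interpret K2: real_distribution K2 by fact
  have *: "distr K1 borel ennreal = distr K2 borel ennreal"
    using moments
    by (intro enexp_moments_unique K1.finite_measure_distr K2.finite_measure_distr)
      (simp_all add: nn_integral_distr)
  have **: "distr (distr K borel ennreal) borel enn2real = K"
    if K: "real_distribution K" "AE x in K. 0 \<le> x" for K
  proof -
    interpret K: real_distribution K by fact
    have "distr (distr K borel ennreal) borel enn2real = distr K borel (\<lambda>x. enn2real (ennreal x))"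
      by (subst distr_distr) (auto simp: comp_def)
    also have "\<dots> = distr K borel (\<lambda>x. x)"
      using K(2) by (intro distr_cong_AE) (auto elim: eventually_mono)
    also have "\<dots> = K" by (intro distr_id2) simp
    finally show ?thesis .
  qed
  show ?thesis
    using *[THEN arg_cong, of "\<lambda>L. distr L borel enn2real"] **[OF assms(1) nonneg(1)] **[OF assms(2) nonneg(2)]
    by simp
qed

text \<open>The root of order \<open>n\<close> has drift \<open>\<gamma> / n\<close> and Levy
  measure \<open>\<rho> / n\<close>. The exponent is linear in this pair, so \<open>n\<close>
  independent copies add up to the exponent of \<open>L\<close>, and moments identify the law of
  their sum.\<close>

lemma infinitely_divisible_realI:
  assumes \<rho>: "Levy_measure \<rho>" "emeasure \<rho> {\<top>} = 0" and \<gamma>: "0 \<le> \<gamma>"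
    and L: "real_distribution L" "AE x in L. 0 \<le> x"
    and moments: "\<And>n::nat. (\<integral>\<^sup>+x. enexp (ennreal x) ^ n \<partial>L) =
       enexp (of_nat n * (ennreal \<gamma>) + (\<integral>\<^sup>+s. 1 - enexp s ^ n \<partial>\<rho>))"
  shows "infinitely_divisible_real L"
  unfolding infinitely_divisible_real_def
proof (intro conjI allI impI L)
  fix n :: nat assume "0 < n"
  have sets: "sets \<rho> = sets (restrict_space borel {0<..})" using \<rho> by (simp add: Levy_measure_def)
  let ?\<rho> = "scale_measure (ennreal (1 / n)) \<rho>"
  have \<rho>n: "Levy_measure ?\<rho>" "emeasure ?\<rho> {\<top>} = 0" and \<gamma>n: "0 \<le> \<gamma> / n"
    using \<rho> \<gamma> by (auto intro: Levy_measure_scale)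
  obtain K where K: "real_distribution K" "AE x in K. 0 \<le> x"
    and K_mom: "\<And>m::nat. (\<integral>\<^sup>+x. enexp (ennreal x) ^ m \<partial>K) =
       enexp (of_nat m * (ennreal (\<gamma> / n)) + (\<integral>\<^sup>+s. 1 - enexp s ^ m \<partial>?\<rho>))"
    using infinitely_divisible_real_law_exists[OF \<rho>n \<gamma>n] by blast
  interpret K: real_distribution K by fact
  let ?P = "PiM {..<n} (\<lambda>_. K)"
  interpret P: prob_space ?P by (intro prob_space_PiM K.prob_space_axioms)
  interpret PP: product_sigma_finite "\<lambda>_::nat. K"
    by (simp add: product_sigma_finite_def K.sigma_finite_measure_axioms)
  have [measurable]: "(\<lambda>z. \<Sum>i<n. z i) \<in> borel_measurable ?P"
    by (intro borel_measurable_sum) (simp add: measurable_component_singleton)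
  have pos: "AE z in ?P. \<forall>i\<in>{..<n}. 0 \<le> z i"
    by (intro AE_finite_allI AE_PiM_component K K.prob_space_axioms) auto
  have "L = distr ?P borel (\<lambda>z. \<Sum>i<n. z i)"
  proof (rule nonneg_law_unique[OF L(1) _ L(2)])
    show "real_distribution (distr ?P borel (\<lambda>z. \<Sum>i<n. z i))"
      by (rule P.real_distribution_distr) measurable
    show "AE x in distr ?P borel (\<lambda>z. \<Sum>i<n. z i). 0 \<le> x"
      using pos by (subst AE_distr_iff) (auto elim!: eventually_mono intro: sum_nonneg)
    fix m :: nat
    have "(\<integral>\<^sup>+x. enexp (ennreal x) ^ m \<partial>distr ?P borel (\<lambda>z. \<Sum>i<n. z i)) =
        (\<integral>\<^sup>+z. enexp (ennreal (\<Sum>i<n. z i)) ^ m \<partial>?P)"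
      by (subst nn_integral_distr) measurable
    also have "\<dots> = (\<integral>\<^sup>+z. (\<Prod>i<n. enexp (ennreal (z i)) ^ m) \<partial>?P)"
    proof (rule nn_integral_cong_AE, use pos in eventually_elim)
      case (elim z)
      then have "ennreal (\<Sum>i<n. z i) = (\<Sum>i<n. ennreal (z i))" by (intro sum_ennreal[symmetric]) simp
      then show ?case by (simp add: enexp_sum prod_power_distrib)
    qed
    also have "\<dots> = (\<Prod>i<n. \<integral>\<^sup>+x. enexp (ennreal x) ^ m \<partial>K)"
      by (rule PP.product_nn_integral_prod) auto
    also have "\<dots> = enexp (of_nat n * (of_nat m * (ennreal (\<gamma> / n)) + (\<integral>\<^sup>+s. 1 - enexp s ^ m \<partial>?\<rho>)))"
      by (simp add: K_mom enexp_of_nat_mult)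
    also have "(\<integral>\<^sup>+s. 1 - enexp s ^ m \<partial>?\<rho>) = ennreal (1 / n) * (\<integral>\<^sup>+s. 1 - enexp s ^ m \<partial>\<rho>)"
      by (intro nn_integral_scale_measure measurable_restrict_pos[OF sets]) measurable
    also have "of_nat n * (of_nat m * (ennreal (\<gamma> / n)) + ennreal (1 / n) * (\<integral>\<^sup>+s. 1 - enexp s ^ m \<partial>\<rho>)) =
        of_nat m * (of_nat n * ennreal (\<gamma> / n)) + of_nat n * ennreal (1 / n) * (\<integral>\<^sup>+s. 1 - enexp s ^ m \<partial>\<rho>)"
      by (simp add: distrib_left ac_simps)
    also have "of_nat n * ennreal (\<gamma> / n) = ennreal \<gamma>"
      using \<open>0 < n\<close> \<gamma> by (simp add: ennreal_of_nat_eq_real_of_nat flip: ennreal_mult)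
    also have "of_nat n * ennreal (1 / n) = 1"
      using \<open>0 < n\<close> by (simp add: ennreal_of_nat_eq_real_of_nat flip: ennreal_mult)
    finally show "(\<integral>\<^sup>+x. enexp (ennreal x) ^ m \<partial>L) = (\<integral>\<^sup>+x. enexp (ennreal x) ^ m \<partial>distr ?P borel (\<lambda>z. \<Sum>i<n. z i))"
      by (simp add: moments)
  qed
  with K show "\<exists>K. real_distribution K \<and> L = distr (PiM {..<n} (\<lambda>_. K)) borel (\<lambda>z. \<Sum>i<n. z i)"
    by blast
qed

text \<open>If \<open>q\<close> is the mass of \<open>\<rho>\<close> at infinity, no Poisson point
  lies there with probability \<open>p = exp (- q)\<close>. The rest of \<open>\<rho>\<close> gives
  the law on \<open>[0,\<infinity>)\<close>, and \<open>L\<close> is compared with the mixture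
  through moments.\<close>

theorem infinitely_divisibleI:
  assumes L: "prob_space L" "sets L = sets borel"
    and "has_drift_and_Levy_measure L \<gamma> \<rho>"
  shows "infinitely_divisible L"
proof -
  interpret L: prob_space L by fact
  have \<gamma>: "0 \<le> \<gamma>" and \<rho>: "Levy_measure \<rho>"
    and laplace: "\<And>t. 0 < t \<Longrightarrow> (\<integral>\<^sup>+z. enexp (ennreal t * z) \<partial>L) =
       enexp (ennreal (\<gamma> * t) + (\<integral>\<^sup>+s. 1 - enexp (ennreal t * s) \<partial>\<rho>))"
    using assms has_drift_and_Levy_measure_iff[OF L] by auto
  have sets: "sets \<rho> = sets (restrict_space borel {0<..})" using \<rho> by (simp add: Levy_measure_def)
  note meas = measurable_restrict_pos[OF sets]
  have top: "{\<top>} \<in> sets \<rho>"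
    unfolding sets sets_restrict_space by (auto intro!: image_eqI[of _ _ "{\<top>}"])
  have gt1: "{ennreal 1<..} \<in> sets \<rho>"
    unfolding sets sets_restrict_space
    by (auto intro!: image_eqI[of _ _ "{1<..}"] intro: order.strict_trans[of 0 1])
  have "emeasure \<rho> {\<top>} \<le> emeasure \<rho> {ennreal 1<..}"
    by (intro emeasure_mono gt1) auto
  also have "\<dots> < \<top>" using \<rho> by (auto simp: Levy_measure_def dest: spec[of _ "1::real"])
  finally obtain q where q: "emeasure \<rho> {\<top>} = ennreal q" "0 \<le> q"
    by (cases "emeasure \<rho> {\<top>}") auto
  define p where "p = exp (- q)"
  have p: "0 < p" "p \<le> 1" using q by (simp_all add: p_def)
  define \<rho>' where "\<rho>' = density \<rho> (indicator {..<\<top>})"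
  have ind: "indicator {..<\<top>} \<in> borel_measurable \<rho>" by (intro meas) measurable
  have "emeasure \<rho>' {\<top>} = (\<integral>\<^sup>+s. indicator {..<\<top>} s * indicator {\<top>} s \<partial>\<rho>)"
    unfolding \<rho>'_def by (intro emeasure_density ind top)
  also have "\<dots> = (\<integral>\<^sup>+s. 0 \<partial>\<rho>)"
    by (intro nn_integral_cong) (simp split: split_indicator)
  finally have \<rho>': "Levy_measure \<rho>'" "emeasure \<rho>' {\<top>} = 0"
    using \<rho> by (simp_all add: \<rho>'_def Levy_measure_density_indicator)
  have split_\<rho>: "(\<integral>\<^sup>+s. f s \<partial>\<rho>) = (\<integral>\<^sup>+s. f s \<partial>\<rho>') + f \<top> * ennreal q"
    if f [measurable]: "f \<in> borel_measurable borel" for f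
  proof -
    have "(\<integral>\<^sup>+s. f s \<partial>\<rho>) = (\<integral>\<^sup>+s. indicator {..<\<top>} s * f s + f \<top> * indicator {\<top>} s \<partial>\<rho>)"
      by (intro nn_integral_cong) (auto split: split_indicator simp: less_top)
    also have "\<dots> = (\<integral>\<^sup>+s. indicator {..<\<top>} s * f s \<partial>\<rho>) + f \<top> * ennreal q"
      using top by (subst nn_integral_add) (auto intro!: meas simp: nn_integral_cmult_indicator q)
    also have "(\<integral>\<^sup>+s. indicator {..<\<top>} s * f s \<partial>\<rho>) = (\<integral>\<^sup>+s. f s \<partial>\<rho>')"
      unfolding \<rho>'_def by (intro nn_integral_density[symmetric] ind meas f)
    finally show ?thesis .
  qed
  obtain L' where L': "real_distribution L'" "AE x in L'. 0 \<le> x"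
    and mom': "\<And>n::nat. (\<integral>\<^sup>+x. enexp (ennreal x) ^ n \<partial>L') =
       enexp (of_nat n * (ennreal \<gamma>) + (\<integral>\<^sup>+s. 1 - enexp s ^ n \<partial>\<rho>'))"
    using infinitely_divisible_real_law_exists[OF \<rho>' \<gamma>] by blast
  interpret L': real_distribution L' by fact
  have id: "infinitely_divisible_real L'"
    by (rule infinitely_divisible_realI[OF \<rho>' \<gamma> L' mom'])
  \<comment> \<open>A coin with success probability \<open>p\<close> chooses between a value drawn
    from \<open>L'\<close> and infinity, which realizes the mixture as a single law on
    \<open>ennreal\<close>.\<close>
  let ?B = "measure_pmf (bernoulli_pmf p) \<Otimes>\<^sub>M L'"
  let ?Z = "\<lambda>(b, x). if b then ennreal x else \<top>"
  interpret B: prob_space ?B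
    by (intro prob_space_pair prob_space_measure_pmf L'.prob_space_axioms)
  have Z [measurable]: "?Z \<in> borel_measurable ?B" by measurable
  have int_B: "(\<integral>\<^sup>+z. f z \<partial>distr ?B borel ?Z) = ennreal p * (\<integral>\<^sup>+x. f (ennreal x) \<partial>L') + ennreal (1 - p) * f \<top>"
    if [measurable]: "f \<in> borel_measurable borel" for f
  proof -
    have "(\<integral>\<^sup>+z. f z \<partial>distr ?B borel ?Z) = (\<integral>\<^sup>+y. f (?Z y) \<partial>?B)"
      by (rule nn_integral_distr) measurable
    also have "\<dots> = (\<integral>\<^sup>+b. \<integral>\<^sup>+x. f (?Z (b, x)) \<partial>L' \<partial>measure_pmf (bernoulli_pmf p))"
      by (rule L'.nn_integral_fst[symmetric]) measurable
    also have "\<dots> = ennreal p * (\<integral>\<^sup>+x. f (ennreal x) \<partial>L') + ennreal (1 - p) * f \<top>"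
      using p L'.emeasure_space_1 by (simp add: mult.commute)
    finally show ?thesis .
  qed
  have "L = distr ?B borel ?Z"
  proof (rule enexp_moments_unique)
    show "finite_measure L" by (rule L.finite_measure_axioms)
    show "finite_measure (distr ?B borel ?Z)" by (intro B.finite_measure_distr) measurable
    fix n :: nat
    have "(\<integral>\<^sup>+z. enexp z ^ n \<partial>distr ?B borel ?Z) =
        ennreal p * (\<integral>\<^sup>+x. enexp (ennreal x) ^ n \<partial>L') + ennreal (1 - p) * enexp \<top> ^ n"
      by (rule int_B) measurable
    also have "\<dots> = (\<integral>\<^sup>+z. enexp z ^ n \<partial>L)"
    \<comment> \<open>At order 0 the value infinity contributes, as \<open>0 ^ 0 = 1\<close>, and
      the claim is that the masses add up to 1. For \<open>n > 0\<close> it contributes nothing, and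
      the mass \<open>q\<close> in the exponent gives exactly the factor \<open>p\<close>.\<close>
    proof (cases "n = 0")
      case True
      then show ?thesis
        using p L.emeasure_space_1 L'.emeasure_space_1 by (simp flip: ennreal_plus)
    next
      case False
      have "(\<integral>\<^sup>+z. enexp z ^ n \<partial>L) = (\<integral>\<^sup>+z. enexp (ennreal n * z) \<partial>L)"
        by (simp add: enexp_real_mult)
      also have "\<dots> = enexp (ennreal (\<gamma> * n) + (\<integral>\<^sup>+s. 1 - enexp (ennreal n * s) \<partial>\<rho>))"
        using False by (intro laplace) simp
      also have "\<dots> = enexp (of_nat n * ennreal \<gamma> + ((\<integral>\<^sup>+s. 1 - enexp s ^ n \<partial>\<rho>') + (1 - enexp \<top> ^ n) * ennreal q))"
        using \<gamma> by (subst split_\<rho>) (simp_all add: enexp_real_mult ennreal_mult_real add.assoc)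
      also have "\<dots> = ennreal p * (\<integral>\<^sup>+x. enexp (ennreal x) ^ n \<partial>L')"
        using False q by (simp add: mom' enexp_add enexp_ennreal p_def ac_simps power_0_left)
      finally show ?thesis using False by (simp add: power_0_left)
    qed
    finally show "(\<integral>\<^sup>+z. enexp z ^ n \<partial>L) = (\<integral>\<^sup>+z. enexp z ^ n \<partial>distr ?B borel ?Z)" ..
  qed (use L in simp_all)
  then have "emeasure L A = ennreal p * emeasure (distr L' borel ennreal) A +
      ennreal (1 - p) * emeasure (return borel \<infinity>) A" if [measurable]: "A \<in> sets borel" for A
    using int_B[of "indicator A"] nn_integral_distr[of ennreal L' borel "indicator A"] by simp
  then show ?thesis
    unfolding infinitely_divisible_def using L(2) p id L'(2) by blast
qed

text \<open>The function \<open>1 - exp (- s)\<close> is bounded below by a multiple of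
  \<open>s\<close> on \<open>(0,1]\<close> and by a positive constant on each
  \<open>(\<epsilon>,\<infinity>]\<close>, so one finite integral covers both conditions.\<close>

lemma Levy_measureI:
  assumes sets: "sets \<rho> = sets (restrict_space borel {0<..})"
    and fin: "(\<integral>\<^sup>+s. 1 - enexp s \<partial>\<rho>) < \<top>"
  shows "Levy_measure \<rho>"
proof -
  note meas = measurable_restrict_pos[OF sets]
  \<comment> \<open>The constant 2 comes from
    \<open>exp (- x) \<le> 1 / (1 + x) \<le> 1 - x / 2\<close> for
    \<open>0 \<le> x \<le> 1\<close>.\<close>
  have small: "s * indicator {0<..1} s \<le> 2 * (1 - enexp s)" for s :: ennreal
  proof (cases "s \<in> {0<..1}")
    case True
    then obtain x where x: "s = ennreal x" "0 \<le> x" "x \<le> 1" by (cases s) (auto simp: top_unique)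
    have "1 + x \<le> exp x" by (rule exp_ge_add_one_self)
    then have "exp (- x) \<le> 1 / (1 + x)"
      using x by (simp add: exp_minus field_simps)
    also have "\<dots> \<le> 1 - x / 2"
      using x by (simp add: field_simps mult_left_le)
    finally have "ennreal x \<le> ennreal (2 * (1 - exp (- x)))" by (intro ennreal_leI) simp
    also have "\<dots> = 2 * (1 - enexp s)"
      using x ennreal_mult[of 2 "1 - exp (- x)"] by (simp add: enexp_ennreal one_minus_ennreal)
    finally show ?thesis using True x by simp
  qed simp
  have "emeasure \<rho> {ennreal \<epsilon><..} < \<infinity>" if "0 < \<epsilon>" for \<epsilon>
  proof -
    have "{ennreal \<epsilon><..} \<in> sets \<rho>"
      unfolding sets sets_restrict_space
      by (auto intro!: image_eqI[of _ _ "{ennreal \<epsilon><..}"] intro: le_less_trans[OF zero_le])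
    define r where "r = 1 / (1 - exp (- \<epsilon>))"
    have r: "0 < r" "r * (1 - exp (- \<epsilon>)) = 1" using that by (simp_all add: r_def)
    have le: "indicator {ennreal \<epsilon><..} s \<le> ennreal r * (1 - enexp s)" for s
    proof (cases "ennreal \<epsilon> < s")
      case True
      have "1 = ennreal r * (1 - enexp (ennreal \<epsilon>))"
        using that r by (simp add: enexp_ennreal one_minus_ennreal flip: ennreal_mult)
      also have "\<dots> \<le> ennreal r * (1 - enexp s)"
        using True by (intro mult_left_mono ennreal_minus_mono enexp_antimono) auto
      finally show ?thesis using True by simp
    qed simp
    have "emeasure \<rho> {ennreal \<epsilon><..} = (\<integral>\<^sup>+s. indicator {ennreal \<epsilon><..} s \<partial>\<rho>)"
      using \<open>{ennreal \<epsilon><..} \<in> sets \<rho>\<close> by simp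
    also have "\<dots> \<le> (\<integral>\<^sup>+s. ennreal r * (1 - enexp s) \<partial>\<rho>)"
      by (intro nn_integral_mono le)
    also have "\<dots> = ennreal r * (\<integral>\<^sup>+s. 1 - enexp s \<partial>\<rho>)"
      by (intro nn_integral_cmult meas) measurable
    also have "\<dots> < \<infinity>" using fin by (simp add: ennreal_mult_less_top)
    finally show ?thesis .
  qed
  moreover have "(\<integral>\<^sup>+ s \<in> {0<..1}. s \<partial>\<rho>) < \<infinity>"
  proof -
    have "(\<integral>\<^sup>+ s \<in> {0<..1}. s \<partial>\<rho>) \<le> (\<integral>\<^sup>+s. 2 * (1 - enexp s) \<partial>\<rho>)"
      by (intro nn_integral_mono small)
    also have "\<dots> = 2 * (\<integral>\<^sup>+s. 1 - enexp s \<partial>\<rho>)"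
      by (intro nn_integral_cmult meas) measurable
    also have "\<dots> < \<infinity>" using fin by (simp add: ennreal_mult_less_top)
    finally show ?thesis .
  qed
  ultimately show ?thesis using sets by (simp add: Levy_measure_def)
qed

theorem drift_and_Levy_measure_unique:
  assumes L: "prob_space L" "sets L = sets borel"
    and "has_drift_and_Levy_measure L \<gamma>1 \<rho>1" "has_drift_and_Levy_measure L \<gamma>2 \<rho>2"
  shows "\<gamma>1 = \<gamma>2 \<and> \<rho>1 = \<rho>2"
proof -
  note iff = has_drift_and_Levy_measure_iff[OF L]
  have "ennreal (\<gamma>1 * n) + (\<integral>\<^sup>+s. 1 - enexp (ennreal n * s) \<partial>\<rho>1) =
      ennreal (\<gamma>2 * n) + (\<integral>\<^sup>+s. 1 - enexp (ennreal n * s) \<partial>\<rho>2)" if "0 < n" for n :: nat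
  proof -
    have "0 < real n" using that by simp
    then have "enexp (ennreal (\<gamma>1 * n) + (\<integral>\<^sup>+s. 1 - enexp (ennreal n * s) \<partial>\<rho>1)) =
        enexp (ennreal (\<gamma>2 * n) + (\<integral>\<^sup>+s. 1 - enexp (ennreal n * s) \<partial>\<rho>2))"
      using assms(3,4) unfolding iff by metis
    then show ?thesis by (simp only: enexp_inj)
  qed
  moreover have "Levy_measure \<rho>1" "Levy_measure \<rho>2" "0 \<le> \<gamma>1" "0 \<le> \<gamma>2"
    using assms(3,4) unfolding iff by simp_all
  ultimately show ?thesis
    using Levy_exponent_unique[of \<rho>1 \<rho>2 \<gamma>1 \<gamma>2] by simp
qed

section \<open>Avoidance probabilities\<close>

definition avoiding :: "'a set \<Rightarrow> ('a \<Rightarrow> bool) set" where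
  "avoiding J = {B. \<forall>j\<in>J. \<not> B j}"

text \<open>Avoidance events generate because a Boolean coordinate admits only four events, all
  obtained from \<open>avoiding {i}\<close> by complement or trivial.\<close>

lemma sets_borel_avoiding:
  "sets (borel :: (nat \<Rightarrow> bool) measure) = sigma_sets UNIV (avoiding ` {J. finite J})"
proof
  have coord: "{B :: nat \<Rightarrow> bool. B i} \<in> sets borel" for i
  proof -
    have "(\<lambda>B :: nat \<Rightarrow> bool. B i) \<in> measurable borel borel"
      by (intro borel_measurable_continuous_onI continuous_on_product_coordinates)
    then have "(\<lambda>B :: nat \<Rightarrow> bool. B i) -` {True} \<inter> space borel \<in> sets borel"
      by (rule measurable_sets) (simp add: borel_open Topological_Spaces.open_discrete)
    then show ?thesis by (simp add: vimage_def)
  qed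
  have avoid: "avoiding J \<in> sets borel" if "finite J" for J :: "nat set"
  proof -
    have "UNIV - {B :: nat \<Rightarrow> bool. B j} \<in> sets borel" for j
      using sets.compl_sets[OF coord[of j]] by simp
    then have "(\<Inter>j\<in>J. UNIV - {B :: nat \<Rightarrow> bool. B j}) \<in> sets borel"
      using that by (cases "J = {}", simp) (intro sets.finite_INT, auto)
    also have "(\<Inter>j\<in>J. UNIV - {B :: nat \<Rightarrow> bool. B j}) = avoiding J" by (auto simp: avoiding_def)
    finally show ?thesis .
  qed
  show "sigma_sets UNIV (avoiding ` {J. finite J}) \<subseteq> sets (borel :: (nat \<Rightarrow> bool) measure)"
    using sets.sigma_sets_subset[of "avoiding ` {J. finite J}" "borel :: (nat \<Rightarrow> bool) measure"] avoid by auto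
  have "sets (borel :: (nat \<Rightarrow> bool) measure) = sets (PiM UNIV (\<lambda>_. count_space UNIV))"
    unfolding sets_Pi_measure[of 0, symmetric] Pi_measure_def by (intro sets_PiM_cong) auto
  also have "\<dots> = sigma_sets UNIV {{f. f i \<in> A} |i A. A \<in> sets (count_space UNIV)}"
    unfolding sets_PiM_single by simp
  also have "\<dots> \<subseteq> sigma_sets UNIV (avoiding ` {J. finite J})"
  proof (rule sigma_sets_mono, safe)
    fix i :: nat and A :: "bool set"
    have basic: "avoiding {i} \<in> sigma_sets UNIV (avoiding ` {J. finite J})"
      by (intro sigma_sets.Basic) auto
    have "A \<in> Pow {True, False}" by auto
    then have "A \<in> {{}, UNIV, {False}, {True}}" by (auto simp: Pow_insert UNIV_bool)
    then have "{f. f i \<in> A} \<in> {{}, UNIV, avoiding {i}, UNIV - avoiding {i}}"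
      by (auto simp: avoiding_def)
    then show "{f. f i \<in> A} \<in> sigma_sets UNIV (avoiding ` {J. finite J})"
      using basic sigma_sets.Compl[OF basic] sigma_sets.Empty[of UNIV "avoiding ` {J. finite J}"]
        sigma_sets_top[of UNIV "avoiding ` {J. finite J}"] by auto
  qed
  finally show "sets (borel :: (nat \<Rightarrow> bool) measure) \<subseteq> sigma_sets UNIV (avoiding ` {J. finite J})" .
qed

lemma avoiding_sets [measurable]: "finite J \<Longrightarrow> avoiding (J :: nat set) \<in> sets borel"
  unfolding sets_borel_avoiding by (intro sigma_sets.Basic) auto

text \<open>Avoiding \<open>J\<close> and avoiding \<open>K\<close> together means avoiding
  \<open>J \<union> K\<close>, so the generator is stable under intersection and the pi-lambda
  theorem applies.\<close>

lemma law_eqI_avoiding: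
  fixes M N :: "(nat \<Rightarrow> bool) measure"
  assumes "prob_space M" "prob_space N" and sets: "sets M = sets borel" "sets N = sets borel"
    and avoid: "\<And>J. finite J \<Longrightarrow> emeasure M (avoiding J) = emeasure N (avoiding J)"
  shows "M = N"
proof (rule measure_eqI_generator_eq[where \<Omega> = UNIV and A = "\<lambda>_. avoiding {}"])
  show "Int_stable (avoiding ` {J :: nat set. finite J})"
  proof (rule Int_stableI_image)
    fix J K :: "nat set" assume "J \<in> {J. finite J}" "K \<in> {J. finite J}"
    then show "\<exists>I\<in>{J. finite J}. avoiding J \<inter> avoiding K = avoiding I"
      by (intro bexI[of _ "J \<union> K"]) (auto simp: avoiding_def)
  qed
  show "range (\<lambda>_. avoiding {}) \<subseteq> avoiding ` {J :: nat set. finite J}" by auto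
  show "(\<Union>i::nat. avoiding {}) = (UNIV :: (nat \<Rightarrow> bool) set)" by (simp add: avoiding_def)
  show "emeasure M (avoiding {}) \<noteq> \<infinity>"
    using prob_space.emeasure_le_1[OF assms(1)] by (metis ennreal_one_neq_top infinity_ennreal_def top.extremum_unique)
  show "sets M = sigma_sets UNIV (avoiding ` {J. finite J})" "sets N = sigma_sets UNIV (avoiding ` {J. finite J})"
    by (simp_all only: sets sets_borel_avoiding)
  show "emeasure M X = emeasure N X" if "X \<in> avoiding ` {J. finite J}" for X
    using that avoid by blast
qed simp

definition hitting :: "'a set \<Rightarrow> ('a \<Rightarrow> bool) set" where
  "hitting J = {B. \<exists>j\<in>J. B j}"

lemma hitting_sets:
  assumes "finite J"
  shows "hitting (J :: nat set) \<in> sets nonempty_subsets"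
proof -
  have "hitting J = UNIV - avoiding J" by (auto simp: hitting_def avoiding_def)
  then have "hitting J \<in> sets borel"
    using sets.compl_sets[OF avoiding_sets[OF assms]] by simp
  moreover have "hitting J \<subseteq> {B. \<exists>i. B i}" by (auto simp: hitting_def)
  ultimately show ?thesis
    by (auto simp: nonempty_subsets_def sets_restrict_space)
qed

lemma union_process_avoiding:
  "union_process Y \<omega> \<in> avoiding J \<longleftrightarrow> num_points (Y \<omega>) (hitting J) = 0"
proof -
  have "num_points (Y \<omega>) (hitting J) = 0 \<longleftrightarrow> {j. \<exists>b\<in>hitting J. Y \<omega> j = Some b} = {}"
    by (simp add: num_points_def emeasure_count_space_eq_0)
  also have "\<dots> \<longleftrightarrow> union_process Y \<omega> \<in> avoiding J"
    by (auto simp: union_process_def avoiding_def hitting_def)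
  finally show ?thesis by simp
qed

text \<open>Measurability is checked on the generating avoidance events only, where it is that of a
  count. If \<open>hitting J\<close> has infinite intensity, the count is almost surely infinite and
  the value \<open>enexp \<infinity> = 0\<close> is still right.\<close>

lemma
  fixes \<nu> :: "(nat \<Rightarrow> bool) measure"
  assumes P: "poisson_process P Y \<nu>" and sets: "sets \<nu> = sets nonempty_subsets"
  shows measurable_union_process: "union_process Y \<in> measurable P borel"
    and emeasure_union_process_avoiding: "finite J \<Longrightarrow>
      emeasure (distr P borel (union_process Y)) (avoiding J) = enexp (emeasure \<nu> (hitting J))"
proof -
  interpret P: prob_space P using P by (simp add: poisson_process_def)
  have hit: "hitting J \<in> sets \<nu>" if "finite J" for J
    using hitting_sets[OF that] by (simp add: sets)
  have [measurable]: "(\<lambda>\<omega>. num_points (Y \<omega>) (hitting J)) \<in> borel_measurable P" if "finite J" for J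
    using P hit[OF that] by (simp add: poisson_process_def)
  have vimage: "union_process Y -` avoiding J \<inter> space P = {\<omega> \<in> space P. num_points (Y \<omega>) (hitting J) = 0}" for J
    using union_process_avoiding[of Y _ J] by auto
  show meas: "union_process Y \<in> measurable P borel"
    by (rule measurable_sigma_sets[OF sets_borel_avoiding]) (auto simp: vimage)
  assume J: "finite J"
  have "emeasure (distr P borel (union_process Y)) (avoiding J) =
      emeasure P {\<omega> \<in> space P. num_points (Y \<omega>) (hitting J) = 0}"
    using J by (simp add: emeasure_distr[OF meas] vimage)
  also have "\<dots> = enexp (emeasure \<nu> (hitting J))"
  proof (cases "emeasure \<nu> (hitting J) = \<infinity>")
    case True
    then have "AE \<omega> in P. num_points (Y \<omega>) (hitting J) = \<infinity>"
      using P hit[OF J] by (simp add: poisson_process_def)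
    then have "AE \<omega> in P. \<not> num_points (Y \<omega>) (hitting J) = 0"
      by (auto elim: eventually_mono)
    then show ?thesis
      using True J by (simp add: emeasure_eq_0_AE)
  next
    case False
    have "\<forall>A\<in>sets \<nu>. emeasure \<nu> A < \<infinity> \<longrightarrow>
        (\<forall>n::nat. measure P {\<omega> \<in> space P. num_points (Y \<omega>) A = of_nat n} =
           measure \<nu> A ^ n / fact n * exp (- measure \<nu> A))"
      using P unfolding poisson_process_def by (elim conjE)
    from this[rule_format, OF hit[OF J], of 0]
    have "measure P {\<omega> \<in> space P. num_points (Y \<omega>) (hitting J) = 0} = exp (- measure \<nu> (hitting J))"
      using False by (simp add: less_top)
    then show ?thesis
      using False by (simp add: P.emeasure_eq_measure emeasure_eq_ennreal_measure enexp_ennreal)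
  qed
  finally show "emeasure (distr P borel (union_process Y)) (avoiding J) = enexp (emeasure \<nu> (hitting J))" .
qed

lemma emeasure_Pi_measure_avoiding:
  assumes x: "0 \<le> x" "x \<le> 1" and J: "finite J"
  shows "emeasure (Pi_measure x) (avoiding J) = ennreal (1 - x) ^ card J"
proof -
  interpret product_prob_space "\<lambda>_::nat. measure_pmf (bernoulli_pmf x)" UNIV
    by (rule product_prob_spaceI) (rule prob_space_measure_pmf)
  have "avoiding J = prod_emb UNIV (\<lambda>_. measure_pmf (bernoulli_pmf x)) J (\<Pi>\<^sub>E j\<in>J. {False})"
    by (auto simp: avoiding_def prod_emb_def restrict_PiE_iff simp del: ext_funcset_to_sing_iff)
  then have "emeasure (Pi_measure x) (avoiding J) = (\<Prod>j\<in>J. emeasure (measure_pmf (bernoulli_pmf x)) {False})"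
    unfolding Pi_measure_def using J
    by (simp add: emeasure_PiM_emb del: ext_funcset_to_sing_iff prod_constant)
  then show ?thesis using x by (simp add: emeasure_pmf_single)
qed

lemma emeasure_Pi_measure_hitting:
  assumes x: "0 \<le> x" "x \<le> 1" and J: "finite J"
  shows "emeasure (Pi_measure x) (hitting J) = 1 - ennreal (1 - x) ^ card J"
proof -
  interpret prob_space "Pi_measure x" by (rule prob_space_Pi_measure)
  have space: "space (Pi_measure x) = UNIV"
    using sets_eq_imp_space_eq[OF sets_Pi_measure] by simp
  have "hitting J = space (Pi_measure x) - avoiding J" by (auto simp: hitting_def avoiding_def space)
  then have "emeasure (Pi_measure x) (hitting J) = emeasure (Pi_measure x) (space (Pi_measure x)) - emeasure (Pi_measure x) (avoiding J)"
    using J by (simp add: emeasure_compl sets_Pi_measure)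
  then show ?thesis
    using emeasure_space_1 emeasure_Pi_measure_avoiding[OF assms] by simp
qed

lemma emeasure_bind_Pi_measure_avoiding:
  assumes \<mu>: "prob_space \<mu>" "sets \<mu> = sets (restrict_space borel {0..1})" and J: "finite J"
  shows "emeasure (bind \<mu> Pi_measure) (avoiding J) = (\<integral>\<^sup>+x. ennreal (1 - x) ^ card J \<partial>\<mu>)"
proof -
  have space: "space \<mu> = {0..1}" using sets_eq_imp_space_eq[OF \<mu>(2)] by (simp add: space_restrict_space)
  have "Pi_measure \<in> measurable \<mu> (subprob_algebra borel)"
    using measurable_restrict_space1[OF measurable_prob_algebraD[OF measurable_Pi_measure]]
      measurable_cong_sets[OF \<mu>(2) refl] by blast
  then have "emeasure (bind \<mu> Pi_measure) (avoiding J) = (\<integral>\<^sup>+x. emeasure (Pi_measure x) (avoiding J) \<partial>\<mu>)"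
    using J by (intro emeasure_bind[where N = borel]) (auto simp: space)
  also have "\<dots> = (\<integral>\<^sup>+x. ennreal (1 - x) ^ card J \<partial>\<mu>)"
    using J by (intro nn_integral_cong emeasure_Pi_measure_avoiding) (auto simp: space)
  finally show ?thesis .
qed

lemma emeasure_mixture_intensity_hitting:
  assumes \<sigma>: "sets \<sigma> = sets (restrict_space borel {0<..1})" and J: "finite J"
  shows "emeasure (mixture_intensity c \<sigma>) (hitting J) =
    of_nat (card J) * ennreal c + (\<integral>\<^sup>+x. 1 - ennreal (1 - x) ^ card J \<partial>\<sigma>)"
proof -
  have space: "space \<sigma> = {0<..1}" using sets_eq_imp_space_eq[OF \<sigma>] by (simp add: space_restrict_space)
  have "(\<Sum>i. indicator (hitting J) (singleton_subset i)) = (\<Sum>i. indicator J i :: ennreal)"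
    by (intro suminf_cong) (auto simp: hitting_def singleton_subset_def split: split_indicator)
  also have "\<dots> = (\<Sum>i\<in>J. 1)"
    using J by (subst suminf_finite[OF J]) auto
  finally have "(\<Sum>i. indicator (hitting J) (singleton_subset i)) = (of_nat (card J) :: ennreal)" by simp
  moreover have "(\<integral>\<^sup>+x. emeasure (Pi_measure x) (hitting J) \<partial>\<sigma>) = (\<integral>\<^sup>+x. 1 - ennreal (1 - x) ^ card J \<partial>\<sigma>)"
    using J by (intro nn_integral_cong emeasure_Pi_measure_hitting) (auto simp: space)
  ultimately show ?thesis
    by (simp add: emeasure_mixture_intensity[OF \<sigma> hitting_sets[OF J]] mult.commute)
qed

text \<open>Only the Dirac part charges singletons. Under \<open>Pi_measure x\<close> with
  \<open>x > 0\<close>, a singleton forces any \<open>n\<close> further coordinates to vanish, which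
  has probability \<open>(1 - x) ^ n\<close>.\<close>

lemma emeasure_mixture_intensity_singleton:
  assumes \<sigma>: "sets \<sigma> = sets (restrict_space borel {0<..1})"
  shows "emeasure (mixture_intensity c \<sigma>) {singleton_subset i} = ennreal c"
proof -
  have space: "space \<sigma> = {0<..1}" using sets_eq_imp_space_eq[OF \<sigma>] by (simp add: space_restrict_space)
  \<comment> \<open>The sets \<open>{..<n} - {i}\<close> exhaust all other indices, so the singleton
    is a countable combination of avoidance events and hence measurable.\<close>
  have "{singleton_subset i} = (\<Inter>n. avoiding ({..<n} - {i})) - avoiding {i}"
  proof (rule set_eqI)
    fix B :: "nat \<Rightarrow> bool"
    have "B \<in> (\<Inter>n. avoiding ({..<n} - {i})) - avoiding {i} \<longleftrightarrow> (\<forall>j. B j \<longleftrightarrow> j = i)"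
      unfolding avoiding_def by (auto; metis lessI)
    then show "B \<in> {singleton_subset i} \<longleftrightarrow> B \<in> (\<Inter>n. avoiding ({..<n} - {i})) - avoiding {i}"
      by (simp add: singleton_subset_def fun_eq_iff)
  qed
  moreover have "(\<Inter>n. avoiding ({..<n} - {i})) - avoiding {i} \<in> sets borel"
    by (intro sets.Diff sets.countable_INT) auto
  ultimately have "{singleton_subset i} \<in> sets borel" by simp
  moreover have "{singleton_subset i} \<subseteq> {B. \<exists>i. B i}" by (auto simp: singleton_subset_def)
  ultimately have sing: "{singleton_subset i} \<in> sets nonempty_subsets"
    by (auto simp: nonempty_subsets_def sets_restrict_space)
  have "emeasure (Pi_measure x) {singleton_subset i} = 0" if x: "0 < x" "x \<le> 1" for x
  proof -
    have "emeasure (Pi_measure x) {singleton_subset i} \<le> ennreal ((1 - x) ^ n)" for n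
    proof -
      have "emeasure (Pi_measure x) {singleton_subset i} \<le> emeasure (Pi_measure x) (avoiding {Suc i..<Suc i + n})"
        by (intro emeasure_mono) (simp_all add: sets_Pi_measure, simp add: avoiding_def singleton_subset_def)
      then show ?thesis using x by (simp add: emeasure_Pi_measure_avoiding ennreal_power)
    qed
    moreover have "(\<lambda>n. ennreal ((1 - x) ^ n)) \<longlonglongrightarrow> ennreal 0"
      using x by (intro tendsto_ennrealI LIMSEQ_realpow_zero) auto
    ultimately have "emeasure (Pi_measure x) {singleton_subset i} \<le> ennreal 0"
      by (intro LIMSEQ_le_const[of "\<lambda>n. ennreal ((1 - x) ^ n)"]) auto
    then show ?thesis by simp
  qed
  then have "(\<integral>\<^sup>+x. emeasure (Pi_measure x) {singleton_subset i} \<partial>\<sigma>) = (\<integral>\<^sup>+x. 0 \<partial>\<sigma>)"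
    by (intro nn_integral_cong) (simp add: space)
  moreover have "(\<Sum>k. indicator {singleton_subset i} (singleton_subset k)) = (1 :: ennreal)"
  proof -
    have "singleton_subset k = singleton_subset i \<longleftrightarrow> k = i" for k
      by (auto simp: singleton_subset_def fun_eq_iff)
    then have "(\<Sum>k. indicator {singleton_subset i} (singleton_subset k)) = (\<Sum>k\<in>{i}. 1 :: ennreal)"
      by (subst suminf_finite[of "{i}"]) auto
    then show ?thesis by simp
  qed
  ultimately show ?thesis
    by (simp add: emeasure_mixture_intensity[OF \<sigma> sing])
qed

section \<open>Change of variables between \<open>(0,1]\<close> and
  \<open>(0,\<infinity>]\<close>\<close>

lemma enexp_phi: "0 \<le> x \<Longrightarrow> x \<le> 1 \<Longrightarrow> enexp (phi x) = ennreal (1 - x)"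
  by (auto simp: phi_def enexp_ennreal)

lemma ennreal_one_minus_phi_inv: "ennreal (1 - phi_inv s) = enexp s"
  by (simp add: phi_inv_def enexp_def)

lemma phi_inv_mem: "s \<in> {0<..} \<Longrightarrow> phi_inv s \<in> {0<..1}"
  by (cases s) (auto simp: phi_inv_def exp_neg_def)

lemma phi_mem: "x \<in> {0<..1} \<Longrightarrow> phi x \<in> {0<..}"
  by (auto simp: phi_def)

lemma measurable_phi_restrict:
  assumes "sets \<sigma> = sets (restrict_space borel {0<..1})"
  shows "phi \<in> measurable \<sigma> (restrict_space borel {0<..})"
proof -
  have "phi \<in> measurable (restrict_space borel {0<..1}) (restrict_space borel {0<..})"
    by (intro measurable_restrict_space2 measurable_restrict_space1 phi_measurable)
      (use phi_mem in \<open>auto simp: space_restrict_space\<close>)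
  then show ?thesis using measurable_cong_sets[OF assms refl] by blast
qed

lemma measurable_phi_inv_restrict:
  assumes "sets \<rho> = sets (restrict_space borel {0<..})"
  shows "phi_inv \<in> measurable \<rho> (restrict_space borel {0<..1})"
proof -
  have "phi_inv \<in> measurable (restrict_space borel {0<..}) (restrict_space borel {0<..1})"
    by (intro measurable_restrict_space2 measurable_restrict_space1 phi_inv_measurable)
      (use phi_inv_mem in \<open>auto simp: space_restrict_space\<close>)
  then show ?thesis using measurable_cong_sets[OF assms refl] by blast
qed

lemma nn_integral_distr_restrict:
  assumes "T \<in> measurable M (restrict_space N \<Omega>)" and "f \<in> borel_measurable N"
  shows "(\<integral>\<^sup>+x. f x \<partial>distr M (restrict_space N \<Omega>) T) = (\<integral>\<^sup>+x. f (T x) \<partial>M)"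
  using assms by (simp add: nn_integral_distr measurable_restrict_space1)

text \<open>Writing the integrand through \<open>enexp s\<close> suits both exponents:
  \<open>phi\<close> turns it into \<open>1 - x\<close>, the probability that a Bernoulli coordinate
  is 0.\<close>

lemma nn_integral_distr_phi:
  assumes \<sigma>: "sets \<sigma> = sets (restrict_space borel {0<..1})" and f: "f \<in> borel_measurable borel"
  shows "(\<integral>\<^sup>+s. f (enexp s) \<partial>distr \<sigma> (restrict_space borel {0<..}) phi) = (\<integral>\<^sup>+x. f (ennreal (1 - x)) \<partial>\<sigma>)"
proof -
  note [measurable] = f
  have space: "space \<sigma> = {0<..1}" using sets_eq_imp_space_eq[OF \<sigma>] by (simp add: space_restrict_space)
  have "(\<integral>\<^sup>+s. f (enexp s) \<partial>distr \<sigma> (restrict_space borel {0<..}) phi) = (\<integral>\<^sup>+x. f (enexp (phi x)) \<partial>\<sigma>)"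
    by (rule nn_integral_distr_restrict[OF measurable_phi_restrict[OF \<sigma>]]) measurable
  also have "\<dots> = (\<integral>\<^sup>+x. f (ennreal (1 - x)) \<partial>\<sigma>)"
    by (intro nn_integral_cong) (simp add: space enexp_phi)
  finally show ?thesis .
qed

lemma nn_integral_distr_phi_inv:
  assumes \<rho>: "sets \<rho> = sets (restrict_space borel {0<..})" and f: "f \<in> borel_measurable borel"
  shows "(\<integral>\<^sup>+x. f (ennreal (1 - x)) \<partial>distr \<rho> (restrict_space borel {0<..1}) phi_inv) = (\<integral>\<^sup>+s. f (enexp s) \<partial>\<rho>)"
proof -
  note [measurable] = f
  have "(\<integral>\<^sup>+x. f (ennreal (1 - x)) \<partial>distr \<rho> (restrict_space borel {0<..1}) phi_inv) =
      (\<integral>\<^sup>+s. f (ennreal (1 - phi_inv s)) \<partial>\<rho>)"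
    by (rule nn_integral_distr_restrict[OF measurable_phi_inv_restrict[OF \<rho>]]) measurable
  then show ?thesis by (simp add: ennreal_one_minus_phi_inv)
qed

section \<open>The two directions of the correspondence\<close>

lemma mixing_law_drift_and_Levy_measure:
  assumes "0 \<le> c" and \<sigma>: "sets \<sigma> = sets (restrict_space borel {0<..1})" "(\<integral>\<^sup>+x. ennreal x \<partial>\<sigma>) < \<infinity>"
    and X: "distributed_as_X M X (mixture_intensity c \<sigma>)"
    and \<mu>: "prob_space \<mu>" "sets \<mu> = sets (restrict_space borel {0..1})"
    and mix: "distr M borel X = bind \<mu> Pi_measure"
  shows "has_drift_and_Levy_measure (distr \<mu> borel phi) c (distr \<sigma> (restrict_space borel {0<..}) phi)"
proof -
  let ?\<nu> = "mixture_intensity c \<sigma>" and ?\<rho> = "distr \<sigma> (restrict_space borel {0<..}) phi"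
  interpret \<mu>: prob_space \<mu> by fact
  have space: "space \<sigma> = {0<..1}" using sets_eq_imp_space_eq[OF \<sigma>(1)] by (simp add: space_restrict_space)
  have space_\<mu>: "space \<mu> = {0..1}" using sets_eq_imp_space_eq[OF \<mu>(2)] by (simp add: space_restrict_space)
  have phi_\<mu>: "phi \<in> borel_measurable \<mu>"
    using measurable_restrict_space1[OF phi_measurable] measurable_cong_sets[OF \<mu>(2) refl] by blast
  obtain P :: "(nat \<Rightarrow> (nat \<Rightarrow> bool) option) measure" and Y
    where P: "poisson_process P Y ?\<nu>" and law: "distr M borel X = distr P borel (union_process Y)"
      and sets_\<nu>: "sets ?\<nu> = sets nonempty_subsets"
    using X unfolding distributed_as_X_def by blast
  \<comment> \<open>The integral of \<open>x\<close> under \<open>\<sigma>\<close> is the integral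
    of \<open>1 - exp (- s)\<close> under the push-forward, whose finiteness suffices for a Levy
    measure.\<close>
  have "(\<integral>\<^sup>+s. 1 - enexp s \<partial>?\<rho>) = (\<integral>\<^sup>+x. 1 - ennreal (1 - x) \<partial>\<sigma>)"
    by (rule nn_integral_distr_phi[OF \<sigma>(1), of "\<lambda>u. 1 - u"]) measurable
  also have "\<dots> = (\<integral>\<^sup>+x. ennreal x \<partial>\<sigma>)"
    by (intro nn_integral_cong) (simp add: space one_minus_ennreal)
  finally have Levy: "Levy_measure ?\<rho>"
    using \<sigma>(2) by (intro Levy_measureI) simp_all
  have moment: "(\<integral>\<^sup>+z. enexp z ^ n \<partial>distr \<mu> borel phi) =
      enexp (of_nat n * ennreal c + (\<integral>\<^sup>+s. 1 - enexp s ^ n \<partial>?\<rho>))" for n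
  proof -
    have "(\<integral>\<^sup>+z. enexp z ^ n \<partial>distr \<mu> borel phi) = (\<integral>\<^sup>+x. enexp (phi x) ^ n \<partial>\<mu>)"
      by (intro nn_integral_distr phi_\<mu>) measurable
    \<comment> \<open>Any set of \<open>n\<close> indices would do, by exchangeability;
      \<open>{..<n}\<close> serves for its cardinality.\<close>
    also have "\<dots> = (\<integral>\<^sup>+x. ennreal (1 - x) ^ card {..<n} \<partial>\<mu>)"
      by (intro nn_integral_cong) (simp add: space_\<mu> enexp_phi)
    also have "\<dots> = emeasure (bind \<mu> Pi_measure) (avoiding {..<n})"
      by (rule emeasure_bind_Pi_measure_avoiding[symmetric]) (use \<mu> in simp_all)
    also have "\<dots> = enexp (emeasure ?\<nu> (hitting {..<n}))"
      unfolding mix[symmetric] law by (rule emeasure_union_process_avoiding[OF P sets_\<nu>]) simp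
    also have "emeasure ?\<nu> (hitting {..<n}) = of_nat n * ennreal c + (\<integral>\<^sup>+x. 1 - ennreal (1 - x) ^ n \<partial>\<sigma>)"
      by (subst emeasure_mixture_intensity_hitting[OF \<sigma>(1)]) simp_all
    also have "(\<integral>\<^sup>+x. 1 - ennreal (1 - x) ^ n \<partial>\<sigma>) = (\<integral>\<^sup>+s. 1 - enexp s ^ n \<partial>?\<rho>)"
      by (rule nn_integral_distr_phi[OF \<sigma>(1), of "\<lambda>u. 1 - u ^ n", symmetric]) measurable
    finally show ?thesis .
  qed
  obtain L where L: "prob_space L" "sets L = sets borel"
    and laplace: "\<And>t. 0 \<le> t \<Longrightarrow> (\<integral>\<^sup>+z. enexp (ennreal t * z) \<partial>L) =
       enexp (ennreal (c * t) + (\<integral>\<^sup>+s. 1 - enexp (ennreal t * s) \<partial>?\<rho>))"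
    using infinitely_divisible_law_exists[OF Levy \<open>0 \<le> c\<close>] by blast
  have "distr \<mu> borel phi = L"
  proof (rule enexp_moments_unique)
    show "finite_measure (distr \<mu> borel phi)" by (rule \<mu>.finite_measure_distr[OF phi_\<mu>])
    show "finite_measure L" by (rule prob_space.finite_measure[OF L(1)])
    show "(\<integral>\<^sup>+z. enexp z ^ n \<partial>distr \<mu> borel phi) = (\<integral>\<^sup>+z. enexp z ^ n \<partial>L)" for n
      using laplace[of "real n"] \<open>0 \<le> c\<close> by (simp add: moment enexp_real_mult ennreal_mult_real)
  qed (use L in simp_all)
  then show ?thesis
    unfolding has_drift_and_Levy_measure_iff[OF L] using laplace Levy \<open>0 \<le> c\<close>
    by (simp add: has_drift_and_Levy_measure_iff[OF L])
qed

text \<open>A Poisson process with the candidate intensity is constructed, and the two laws are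
  compared on avoidance events: the exponent at \<open>t = card J\<close> is the intensity of
  \<open>hitting J\<close>.\<close>

lemma distributed_as_X_mixture:
  fixes M :: "'w measure"
  assumes L: "prob_space L" "sets L = sets borel" "has_drift_and_Levy_measure L \<gamma> \<rho>"
    and \<mu>: "\<mu> = distr L (restrict_space borel {0..1}) phi_inv"
    and X: "prob_space M" "X \<in> measurable M borel" "distr M borel X = bind \<mu> Pi_measure"
    and \<sigma>: "\<sigma> = distr \<rho> (restrict_space borel {0<..1}) phi_inv"
  shows "(\<integral>\<^sup>+x. ennreal x \<partial>\<sigma>) < \<infinity>" and "distributed_as_X M X (mixture_intensity \<gamma> \<sigma>)"
proof -
  interpret L: prob_space L by fact
  interpret M: prob_space M by fact
  let ?\<nu> = "mixture_intensity \<gamma> \<sigma>"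
  have \<gamma>: "0 \<le> \<gamma>" and \<rho>: "Levy_measure \<rho>"
    and laplace: "\<And>t. 0 < t \<Longrightarrow> (\<integral>\<^sup>+z. enexp (ennreal t * z) \<partial>L) =
       enexp (ennreal (\<gamma> * t) + (\<integral>\<^sup>+s. 1 - enexp (ennreal t * s) \<partial>\<rho>))"
    using L(3) has_drift_and_Levy_measure_iff[OF L(1,2)] by auto
  have sets_\<rho>: "sets \<rho> = sets (restrict_space borel {0<..})" using \<rho> by (simp add: Levy_measure_def)
  have sets_\<sigma>: "sets \<sigma> = sets (restrict_space borel {0<..1})" by (simp add: \<sigma>)
  have space_\<sigma>: "space \<sigma> = {0<..1}" using sets_eq_imp_space_eq[OF sets_\<sigma>] by (simp add: space_restrict_space)
  have sets_\<nu>: "sets ?\<nu> = sets nonempty_subsets" by (simp add: mixture_intensity_def)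
  have space_\<nu>: "space ?\<nu> = {B. \<exists>i. B i}"
    using sets_eq_imp_space_eq[OF sets_\<nu>] by (simp add: nonempty_subsets_def space_restrict_space)
  have hit: "emeasure ?\<nu> (hitting J) = of_nat (card J) * ennreal \<gamma> + (\<integral>\<^sup>+s. 1 - enexp s ^ card J \<partial>\<rho>)"
    if "finite J" for J
    unfolding emeasure_mixture_intensity_hitting[OF sets_\<sigma> that]
    using nn_integral_distr_phi_inv[OF sets_\<rho>, of "\<lambda>u. 1 - u ^ card J"] by (simp add: \<sigma>)
  have fin: "(\<integral>\<^sup>+s. 1 - enexp s \<partial>\<rho>) < \<infinity>"
    using Levy_exponent_finite[OF \<rho>, of 1] by simp
  have "(\<integral>\<^sup>+x. ennreal x \<partial>\<sigma>) = (\<integral>\<^sup>+x. 1 - ennreal (1 - x) \<partial>\<sigma>)"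
    by (intro nn_integral_cong) (simp add: space_\<sigma> one_minus_ennreal)
  also have "\<dots> = (\<integral>\<^sup>+s. 1 - enexp s \<partial>\<rho>)"
    unfolding \<sigma> by (rule nn_integral_distr_phi_inv[OF sets_\<rho>, of "\<lambda>u. 1 - u"]) measurable
  finally show "(\<integral>\<^sup>+x. ennreal x \<partial>\<sigma>) < \<infinity>" using fin by simp
  have sigma_fin: "sigma_finite_measure ?\<nu>"
  proof
    \<comment> \<open>Every nonempty subset hits some \<open>{i}\<close>, and
      \<open>hitting {i}\<close> has finite mass
      \<open>\<gamma> + \<integral> (1 - exp (- s)) d\<rho>(s)\<close>, even when the total mass is
      infinite.\<close>
    show "\<exists>A. countable A \<and> A \<subseteq> sets ?\<nu> \<and> \<Union> A = space ?\<nu> \<and> (\<forall>a\<in>A. emeasure ?\<nu> a \<noteq> \<infinity>)"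
    proof (intro exI conjI ballI)
      show "range (\<lambda>i::nat. hitting {i}) \<subseteq> sets ?\<nu>" by (auto simp: sets_\<nu> hitting_sets)
      show "\<Union> (range (\<lambda>i::nat. hitting {i})) = space ?\<nu>" by (auto simp: space_\<nu> hitting_def)
      show "emeasure ?\<nu> a \<noteq> \<infinity>" if "a \<in> range (\<lambda>i. hitting {i})" for a
        using that fin by (auto simp: hit)
    qed simp
  qed
  have "singleton_subset 0 \<in> space ?\<nu>" by (simp add: space_\<nu> singleton_subset_def)
  then have "space ?\<nu> \<noteq> {}" by blast
  from poisson_process_exists[OF sigma_fin this]
  obtain P :: "(nat \<Rightarrow> (nat \<Rightarrow> bool) option) measure" where P: "poisson_process P (\<lambda>y. y) ?\<nu>" by blast
  interpret P: prob_space P using P by (simp add: poisson_process_def)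
  have phi_inv_L: "phi_inv \<in> measurable L (restrict_space borel {0..1})"
  proof -
    have "phi_inv \<in> measurable borel (restrict_space borel {0..1})"
      by (intro measurable_restrict_space2 phi_inv_measurable) (simp add: phi_inv_def)
    then show ?thesis using measurable_cong_sets[OF L(2) refl] by blast
  qed
  have "distr M borel X = distr P borel (union_process (\<lambda>y. y))"
  proof (rule law_eqI_avoiding)
    show "prob_space (distr M borel X)" by (rule M.prob_space_distr[OF X(2)])
    show "prob_space (distr P borel (union_process (\<lambda>y. y)))"
      by (rule P.prob_space_distr[OF measurable_union_process[OF P sets_\<nu>]])
    fix J :: "nat set" assume J: "finite J"
    have "emeasure (distr M borel X) (avoiding J) = (\<integral>\<^sup>+x. ennreal (1 - x) ^ card J \<partial>\<mu>)"
      unfolding X(3) using J by (intro emeasure_bind_Pi_measure_avoiding)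
        (simp_all add: \<mu> L.prob_space_distr[OF phi_inv_L])
    also have "\<dots> = (\<integral>\<^sup>+z. ennreal (1 - phi_inv z) ^ card J \<partial>L)"
      unfolding \<mu> by (rule nn_integral_distr_restrict[OF phi_inv_L]) measurable
    also have "\<dots> = (\<integral>\<^sup>+z. enexp (ennreal (card J) * z) \<partial>L)"
      by (simp add: ennreal_one_minus_phi_inv enexp_real_mult)
    also have "\<dots> = enexp (emeasure ?\<nu> (hitting J))"
    \<comment> \<open>The drift formula is available for positive \<open>t\<close> only; for empty
      \<open>J\<close> both sides are 1.\<close>
    proof (cases "J = {}")
      case True
      then show ?thesis by (simp add: hitting_def L.emeasure_space_1)
    next
      case False
      then have "0 < real (card J)" using J by (simp add: card_gt_0_iff)
      from laplace[OF this] show ?thesis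
        using \<gamma> by (simp add: hit J enexp_real_mult ennreal_mult_real)
    qed
    also have "\<dots> = emeasure (distr P borel (union_process (\<lambda>y. y))) (avoiding J)"
      by (rule emeasure_union_process_avoiding[OF P sets_\<nu> J, symmetric])
    finally show "emeasure (distr M borel X) (avoiding J) =
        emeasure (distr P borel (union_process (\<lambda>y. y))) (avoiding J)" .
  qed simp_all
  then show "distributed_as_X M X ?\<nu>"
    unfolding distributed_as_X_def using X(2) sets_\<nu> sigma_fin P by blast
qed

theorem theorem4p5:
  shows "(\<forall>(M :: 'w measure) (X :: 'w \<Rightarrow> nat \<Rightarrow> bool) c \<sigma> \<nu> \<mu> (N :: 'q measure) Q Z.
      prob_space M \<and> X \<in> measurable M borel \<and>
      0 \<le> c \<and>
      sets \<sigma> = sets (restrict_space borel {0<..1}) \<and> (\<integral>\<^sup>+ x. ennreal x \<partial>\<sigma>) < \<infinity> \<and>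
      \<nu> = mixture_intensity c \<sigma> \<and>
      distributed_as_X M X \<nu> \<and>
      prob_space \<mu> \<and> sets \<mu> = sets (restrict_space borel {0..1}) \<and>
      distr M borel X = bind \<mu> Pi_measure \<and>
      prob_space N \<and> Q \<in> measurable N (restrict_space borel {0..1}) \<and>
      distr N (restrict_space borel {0..1}) Q = \<mu> \<and>
      Z = (\<lambda>\<omega>. phi (Q \<omega>))
      \<longrightarrow>
      X \<in> class_R M \<and>
      infinitely_divisible (distr N borel Z) \<and>
      (\<exists>\<gamma> \<rho>. has_drift_and_Levy_measure (distr N borel Z) \<gamma> \<rho>) \<and>
      (\<forall>\<gamma> \<rho>. has_drift_and_Levy_measure (distr N borel Z) \<gamma> \<rho> \<longrightarrow>
         \<rho> = distr \<sigma> (restrict_space borel {0<..}) phi \<and>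
         ennreal \<gamma> = emeasure \<nu> {singleton_subset 1}))
    \<and>
    (\<forall>(N :: 'z measure) (Z :: 'z \<Rightarrow> ennreal) \<gamma> \<rho> \<mu> (M :: 'v measure) (X :: 'v \<Rightarrow> nat \<Rightarrow> bool).
      prob_space N \<and> Z \<in> measurable N borel \<and>
      infinitely_divisible (distr N borel Z) \<and>
      has_drift_and_Levy_measure (distr N borel Z) \<gamma> \<rho> \<and>
      \<mu> = distr N (restrict_space borel {0..1}) (\<lambda>\<omega>. phi_inv (Z \<omega>)) \<and>
      prob_space M \<and> X \<in> measurable M borel \<and>
      distr M borel X = bind \<mu> Pi_measure
      \<longrightarrow>
      X \<in> class_R M \<and>
      (\<exists>c \<sigma> \<nu>.
         0 \<le> c \<and>
         sets \<sigma> = sets (restrict_space borel {0<..1}) \<and> (\<integral>\<^sup>+ x. ennreal x \<partial>\<sigma>) < \<infinity> \<and>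
         \<nu> = mixture_intensity c \<sigma> \<and>
         distributed_as_X M X \<nu> \<and>
         \<sigma> = distr \<rho> (restrict_space borel {0<..1}) phi_inv \<and>
         emeasure \<nu> {singleton_subset 1} = ennreal \<gamma>))"
proof (intro conjI allI impI; elim conjE)
  fix M :: "'w measure" and X :: "'w \<Rightarrow> nat \<Rightarrow> bool" and c \<sigma> \<nu> \<mu> and N :: "'q measure" and Q Z
  assume c: "0 \<le> c" and \<sigma>: "sets \<sigma> = sets (restrict_space borel {0<..1})" "(\<integral>\<^sup>+ x. ennreal x \<partial>\<sigma>) < \<infinity>"
    and \<nu>: "\<nu> = mixture_intensity c \<sigma>" and X: "distributed_as_X M X \<nu>"
    and \<mu>: "prob_space \<mu>" "sets \<mu> = sets (restrict_space borel {0..1})"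
    and mix: "distr M borel X = bind \<mu> Pi_measure"
    and Q: "Q \<in> measurable N (restrict_space borel {0..1})" "distr N (restrict_space borel {0..1}) Q = \<mu>"
    and Z: "Z = (\<lambda>\<omega>. phi (Q \<omega>))"
  let ?\<rho> = "distr \<sigma> (restrict_space borel {0<..}) phi"
  show "X \<in> class_R M" using X by (auto simp: class_R_def)
  have phi_restrict: "phi \<in> borel_measurable (restrict_space borel {0..1})"
    by (rule measurable_restrict_space1) (rule phi_measurable)
  have L_eq: "distr N borel Z = distr \<mu> borel phi"
    unfolding Z Q(2)[symmetric] using distr_distr[OF phi_restrict Q(1)] by (simp add: comp_def)
  have L: "prob_space (distr N borel Z)" "sets (distr N borel Z) = sets borel"
    using prob_space.prob_space_distr[OF \<mu>(1), of phi borel] phi_restrict measurable_cong_sets[OF \<mu>(2) refl]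
    unfolding L_eq by auto
  have drift: "has_drift_and_Levy_measure (distr N borel Z) c ?\<rho>"
    unfolding L_eq using mixing_law_drift_and_Levy_measure[OF c \<sigma> X[unfolded \<nu>] \<mu> mix] .
  then show "infinitely_divisible (distr N borel Z)"
    by (rule infinitely_divisibleI[OF L])
  show "\<exists>\<gamma> \<rho>. has_drift_and_Levy_measure (distr N borel Z) \<gamma> \<rho>" using drift by blast
  \<comment> \<open>The claim concerns every such pair, so uniqueness identifies it with the pair
    just exhibited.\<close>
  fix \<gamma> \<rho> assume "has_drift_and_Levy_measure (distr N borel Z) \<gamma> \<rho>"
  from drift_and_Levy_measure_unique[OF L this drift]
  show "\<rho> = ?\<rho>" "ennreal \<gamma> = emeasure \<nu> {singleton_subset 1}"
    by (simp_all add: \<nu> emeasure_mixture_intensity_singleton[OF \<sigma>(1)])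
next
  fix N :: "'z measure" and Z :: "'z \<Rightarrow> ennreal" and \<gamma> \<rho> \<mu> and M :: "'v measure" and X :: "'v \<Rightarrow> nat \<Rightarrow> bool"
  assume N: "prob_space N" and Z: "Z \<in> measurable N borel"
    and drift: "has_drift_and_Levy_measure (distr N borel Z) \<gamma> \<rho>"
    and \<mu>: "\<mu> = distr N (restrict_space borel {0..1}) (\<lambda>\<omega>. phi_inv (Z \<omega>))"
    and X: "prob_space M" "X \<in> measurable M borel" "distr M borel X = bind \<mu> Pi_measure"
  let ?\<sigma> = "distr \<rho> (restrict_space borel {0<..1}) phi_inv"
  have L: "prob_space (distr N borel Z)" "sets (distr N borel Z) = sets borel"
    using prob_space.prob_space_distr[OF N Z] by simp_all
  have "phi_inv \<in> measurable borel (restrict_space borel {0..1})"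
    by (intro measurable_restrict_space2 phi_inv_measurable) (simp add: phi_inv_def)
  then have \<mu>_eq: "\<mu> = distr (distr N borel Z) (restrict_space borel {0..1}) phi_inv"
    unfolding \<mu> using Z by (simp add: distr_distr comp_def)
  note mixture = distributed_as_X_mixture[OF L drift \<mu>_eq X refl]
  then show "X \<in> class_R M" by (auto simp: class_R_def)
  have sing: "emeasure (mixture_intensity \<gamma> ?\<sigma>) {singleton_subset 1} = ennreal \<gamma>"
    by (rule emeasure_mixture_intensity_singleton) simp
  have "0 \<le> \<gamma>" using drift by (simp add: has_drift_and_Levy_measure_def)
  then show "\<exists>c \<sigma> \<nu>. 0 \<le> c \<and> sets \<sigma> = sets (restrict_space borel {0<..1}) \<and>
      (\<integral>\<^sup>+ x. ennreal x \<partial>\<sigma>) < \<infinity> \<and> \<nu> = mixture_intensity c \<sigma> \<and> distributed_as_X M X \<nu> \<and>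
      \<sigma> = distr \<rho> (restrict_space borel {0<..1}) phi_inv \<and>
      emeasure \<nu> {singleton_subset 1} = ennreal \<gamma>"
    using mixture sing by (intro exI[of _ \<gamma>] exI[of _ ?\<sigma>] exI[of _ "mixture_intensity \<gamma> ?\<sigma>"]) simp
qed

end
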